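(* Let $S$ be a numerical semigroup, $E\subseteq S$ a (nonempty) ideal of $S$, and $d\in S$ odd. Write $S^*=S\setminus\{0\}$, $\tilde E=E\cup\{0\}$ (a numerical semigroup), and let $S\bowtie^d E$ be the numerical duplication of $S$ with respect to $E$ and $d$. Then: (i) Let $E=S$. If $k[[S]]$ has minimal reduced type, then $k[[S\bowtie^d E]]$ has minimal reduced type. (ii) Let $E=S^*$. Then $k[[S\bowtie^d E]]$ is never Gorenstein. Moreover: (a) Suppose $k[[S]]$ is Gorenstein. (a.1) When $d<2\mathrm{F}(S)$, $k[[S\bowtie^d E]]$ has minimal reduced type if and only if $2m(S)<d$. (a.2) When $d>2\mathrm{F}(S)$, $k[[S\bowtie^d E]]$ has minimal reduced type if and only if $m(S)<\mathrm{F}(S)+1$. (b) Suppose $k[[S]]$ is not Gorenstein. (b.1) For $\max \mathrm{PF}'(S\bowtie^d E)\neq 2\mathrm{F}(S)$, if $k[[S]]$ has minimal reduced type, then $k[[S\bowtie^d E]]$ also has minimal reduced type. (b.2) For $\max \mathrm{PF}'(S\bowtie^d E)=2\mathrm{F}(S)$, $k[[S\bowtie^d E]]$ has minimal reduced type if and only if $d>2m(S)$. (iii) Let $E\neq S$ and $E\neq S^*$. (a) Suppose $\mathrm{F}(S)\neq\mathrm{F}(\tilde E)$. If $k[[\tilde E]]$ has minimal reduced type, then $k[[S\bowtie^d E]]$ also has minimal reduced type. (b) Suppose $\mathrm{F}(S)=\mathrm{F}(\tilde E)$. (b.1) For $\max \mathrm{PF}'(S\bowtie^d E)\neq 2\mathrm{F}(S)$,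 if $k[[\tilde E]]$ has minimal reduced type, then $k[[S\bowtie^d E]]$ also has minimal reduced type. (b.2) For $\max \mathrm{PF}'(S\bowtie^d E)=2\mathrm{F}(S)$, $k[[S\bowtie^d E]]$ has minimal reduced type if and only if $d>2m(S)$.
   Context: $\mathbb{N}$ denotes the non-negative integers. A numerical semigroup is a submonoid $S$ of $(\mathbb{N},+)$ with $\mathbb{N}\setminus S$ finite. The multiplicity $m(S)$ is the smallest nonzero element of $S$. A pseudo-Frobenius number of $S$ is an integer $f\in\mathbb{Z}\setminus S$ with $f+s\in S$ for all $s\in S\setminus\{0\}$; $\mathrm{PF}(S)$ is the set of these. The Frobenius number $\mathrm{F}(S)$ is the largest element of $\mathbb{N}\setminus S$; it is the maximum element of $\mathrm{PF}(S)$, and $\mathrm{PF}'(S)=\mathrm{PF}(S)\setminus\{\mathrm{F}(S)\}$. An ideal of $S$ is a subset $E\subseteq S$ with $S+E\subseteq E$. For an odd integer $d\in S$ and an ideal $E\subseteq S$, the numerical duplication of $S$ with respect to $E$ and $d$ is the numerical semigroup $S\bowtie^d E = 2\cdot S\cup(2\cdot E+d)$, where $2\cdot S=\{2s\mid s\in S\}$ and $2\cdot E+d=\{2e+d\mid e\in E\}$. Let $k$ be an algebraically closed field of characteristic zero. For $S$ with minimal generators $n_1,\ldots,n_e$, $R=k[[S]] := k[[t^{n_1},\ldots,t^{n_e}]]\subseteq k[[t]]$. The Cohen-Macaulay type of $k[[S]]$ equals $|\mathrm{PF}(S)|$; in particular $k[[S]]$ is Gorenstein if and only if $|\mathrm{PF}(S)|=1$.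 With $K$ the quotient field of $R$, $\bar R$ its integral closure in $K$ and $\mathfrak{C}=(R:_K\bar R)$ the conductor ideal, the reduced type is $s(R)=\dim_k \frac{\mathfrak{C}+xR}{xR}$ with $x=t^{m(S)}$; it is known to equal the number of integers in $[\mathrm{F}(S)-m(S)+1,\mathrm{F}(S)]\setminus S$. $R$ has minimal reduced type if $s(R)=1$.
   Formalization: Part (ii) is stated for S ≠ ℕ: for S = ℕ, E = ℕ\{0}, the duplication is ⟨2, d+2⟩, whose ring is Gorenstein, and F(S) is undefined, so (ii) fails there; in (i) and (iii) S = ℕ is allowed with F(ℕ) = −1. *)

theory Defs
  imports "HOL-Computational_Algebra.Computational_Algebra"
begin

subsection \<open>Numerical semigroups\<close>

definition numerical_semigroup :: "nat set \<Rightarrow> bool" where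
  "numerical_semigroup S \<longleftrightarrow>
     0 \<in> S \<and> (\<forall>a\<in>S. \<forall>b\<in>S. a + b \<in> S) \<and> finite (UNIV - S)"

definition sg_mult :: "nat set \<Rightarrow> nat" where
  "sg_mult S = (LEAST n. n \<in> S \<and> n \<noteq> 0)"

definition pseudo_frobenius :: "nat set \<Rightarrow> int set" where
  "pseudo_frobenius S = {f. f \<notin> int ` S \<and> (\<forall>s\<in>S - {0}. f + int s \<in> int ` S)}"

text \<open>The largest gap; for \<open>S = \<nat>\<close>, which has no gap, the usual convention is \<open>-1\<close>
  (the only pseudo-Frobenius number of \<open>\<nat>\<close>).\<close>

definition frobenius :: "nat set \<Rightarrow> int" where
  "frobenius S = (if S = UNIV then - 1 else int (Max (UNIV - S)))"

definition pseudo_frobenius' :: "nat set \<Rightarrow> int set" where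
  "pseudo_frobenius' S = pseudo_frobenius S - {frobenius S}"

definition semigroup_ideal :: "nat set \<Rightarrow> nat set \<Rightarrow> bool" where
  "semigroup_ideal S E \<longleftrightarrow> E \<subseteq> S \<and> (\<forall>s\<in>S. \<forall>e\<in>E. s + e \<in> E)"

definition duplication :: "nat set \<Rightarrow> nat set \<Rightarrow> nat \<Rightarrow> nat set" where
  "duplication S E d = {2 * s | s. s \<in> S} \<union> {2 * e + d | e. e \<in> E}"

definition minimal_generators :: "nat set \<Rightarrow> nat set" where
  "minimal_generators S =
     {n \<in> S. n \<noteq> 0 \<and> \<not> (\<exists>a\<in>S - {0}. \<exists>b\<in>S - {0}. n = a + b)}"


subsection \<open>Semigroup rings\<close>

text \<open>For a finite set \<open>G\<close> of positive integers, \<open>k[[t\<^sup>g | g \<in> G]]\<close> is the image of the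
  substitution \<open>x\<^sub>g \<mapsto> t\<^sup>g\<close> on the formal power series \<open>\<Sum>\<^sub>\<alpha> c \<alpha> x\<^sup>\<alpha>\<close> in the variables
  \<open>x\<^sub>g\<close>, \<open>g \<in> G\<close>.  An exponent vector \<open>\<alpha>\<close> is a function vanishing outside \<open>G\<close>; only finitely
  many of them contribute to each coefficient of the image.\<close>

definition gen_power_series :: "nat set \<Rightarrow> 'k::field fps set" where
  "gen_power_series G =
     range (\<lambda>c :: (nat \<Rightarrow> nat) \<Rightarrow> 'k. Abs_fps (\<lambda>j.
       \<Sum>\<alpha> | (\<forall>g. g \<notin> G \<longrightarrow> \<alpha> g = 0) \<and> (\<Sum>g\<in>G. \<alpha> g * g) = j. c \<alpha>))"

text \<open>\<open>k[[S]]\<close>, viewed inside the field \<open>k((t))\<close>.\<close>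

definition semigroup_ring :: "nat set \<Rightarrow> 'k::field fls set" where
  "semigroup_ring S = fps_to_fls ` gen_power_series (minimal_generators S)"


subsection \<open>Ring-theoretic notions for subrings of \<open>k((t))\<close>\<close>

definition quotient_field :: "'k::field fls set \<Rightarrow> 'k fls set" where
  "quotient_field R = {a / b | a b. a \<in> R \<and> b \<in> R \<and> b \<noteq> 0}"

definition integral_closure :: "'k::field fls set \<Rightarrow> 'k fls set" where
  "integral_closure R =
     {z \<in> quotient_field R.
        \<exists>p. lead_coeff p = 1 \<and> (\<forall>i. coeff p i \<in> R) \<and> poly p z = 0}"

definition conductor :: "'k::field fls set \<Rightarrow> 'k fls set" where
  "conductor R = {z \<in> quotient_field R. \<forall>y\<in>integral_closure R. z * y \<in> R}"

definition principal :: "'k::field fls \<Rightarrow> 'k fls set \<Rightarrow> 'k fls set" where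
  "principal x R = {x * r | r. r \<in> R}"

text \<open>For \<open>k\<close>-subspaces \<open>W \<subseteq> V\<close> of \<open>k((t))\<close>: \<open>B\<close> is a finite set of representatives, one for each
  element, of a basis of \<open>V / W\<close>, i.e. every vector of \<open>V\<close> is congruent modulo \<open>W\<close> to exactly
  one linear combination of \<open>B\<close>.\<close>

definition quot_basis :: "'k::field fls set \<Rightarrow> 'k fls set \<Rightarrow> 'k fls set \<Rightarrow> bool" where
  "quot_basis V W B \<longleftrightarrow> finite B \<and> B \<subseteq> V \<and>
     (\<forall>v\<in>V. \<exists>!c. (\<forall>b. b \<notin> B \<longrightarrow> c b = 0) \<and> v - (\<Sum>b\<in>B. fls_const (c b) * b) \<in> W)"

text \<open>\<open>dim\<^sub>k (V / W)\<close>; as for \<^const>\<open>vector_space.dim\<close>, the value is 0 if the dimension is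
  infinite.\<close>

definition quot_dim :: "'k::field fls set \<Rightarrow> 'k fls set \<Rightarrow> nat" where
  "quot_dim V W =
     (if \<exists>B. quot_basis V W B then card (SOME B. quot_basis V W B) else 0)"

definition reduced_type_wrt :: "'k::field fls set \<Rightarrow> 'k fls \<Rightarrow> nat" where
  "reduced_type_wrt R x =
     quot_dim {c + y | c y. c \<in> conductor R \<and> y \<in> principal x R} (principal x R)"

text \<open>The non-units; the maximal ideal when \<open>R\<close> is local.\<close>

definition max_ideal :: "'k::field fls set \<Rightarrow> 'k fls set" where
  "max_ideal R = {r \<in> R. \<not> (\<exists>u\<in>R. r * u = 1)}"

text \<open>The Cohen-Macaulay type of a one-dimensional Cohen-Macaulay local ring \<open>R\<close> with residue
  field \<open>k\<close>: the dimension of the socle \<open>(xR :\<^sub>R \<mm>) / xR\<close> of \<open>R / xR\<close>, where \<open>x\<close> is a parameter.\<close>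

definition cm_type_wrt :: "'k::field fls set \<Rightarrow> 'k fls \<Rightarrow> nat" where
  "cm_type_wrt R x =
     quot_dim {r \<in> R. \<forall>y\<in>max_ideal R. r * y \<in> principal x R} (principal x R)"


subsection \<open>Gorensteinness and minimal reduced type of \<open>k[[S]]\<close>\<close>

text \<open>Both use the parameter \<open>x = t\<^sup>m\<close>, where \<open>m\<close> is the multiplicity of \<open>S\<close>.  The one-dimensional
  local domain \<open>k[[S]]\<close> is Cohen-Macaulay, so it is Gorenstein iff it has type 1.\<close>

definition gorenstein :: "'k::field itself \<Rightarrow> nat set \<Rightarrow> bool" where
  "gorenstein _ S \<longleftrightarrow>
     cm_type_wrt (semigroup_ring S :: 'k fls set) (fls_X ^ sg_mult S) = 1"

definition reduced_type :: "'k::field itself \<Rightarrow> nat set \<Rightarrow> nat" where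
  "reduced_type _ S =
     reduced_type_wrt (semigroup_ring S :: 'k fls set) (fls_X ^ sg_mult S)"

definition minimal_reduced_type :: "'k::field itself \<Rightarrow> nat set \<Rightarrow> bool" where
  "minimal_reduced_type k S \<longleftrightarrow> reduced_type k S = 1"


subsection \<open>Consistency of the definitions\<close>

lemma numerical_semigroup_insert_0_ideal:
  assumes S: "numerical_semigroup S" and E: "semigroup_ideal S E" "E \<noteq> {}"
  shows "numerical_semigroup (insert 0 E)"
proof -
  obtain e where e: "e \<in> E" using E by blast
  have "UNIV - E \<subseteq> {..<e} \<union> (\<lambda>n. n + e) ` (UNIV - S)"
  proof
    fix n assume n: "n \<in> UNIV - E"
    show "n \<in> {..<e} \<union> (\<lambda>n. n + e) ` (UNIV - S)"
    proof (cases "n < e")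
      case False
      then have eq: "n = (n - e) + e" by simp
      then have "n - e \<notin> S" using E e n unfolding semigroup_ideal_def by (metis DiffD2)
      then show ?thesis using eq by blast
    qed simp
  qed
  moreover have "finite (UNIV - S)" using S by (simp add: numerical_semigroup_def)
  ultimately have "finite (UNIV - E)" by (meson finite_UnI finite_imageI finite_lessThan finite_subset)
  then have "finite (UNIV - insert 0 E)" by (rule rev_finite_subset) auto
  then show ?thesis
    using E unfolding numerical_semigroup_def semigroup_ideal_def by (auto simp: subset_eq)
qed

lemma numerical_semigroup_duplication:
  assumes S: "numerical_semigroup S" and E: "semigroup_ideal S E" "E \<noteq> {}"
    and d: "d \<in> S" "odd d"
  shows "numerical_semigroup (duplication S E d)"
proof -
  let ?T = "duplication S E d"
  have fS: "finite (UNIV - S)" using S by (simp add: numerical_semigroup_def)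
  have "finite (UNIV - insert 0 E)"
    using numerical_semigroup_insert_0_ideal[OF S E] by (simp add: numerical_semigroup_def)
  then have "finite (insert 0 (UNIV - insert 0 E))" by simp
  then have fE: "finite (UNIV - E)" by (rule rev_finite_subset) blast
  have "UNIV - ?T \<subseteq> {..<d} \<union> (\<lambda>n. 2 * n) ` (UNIV - S) \<union> (\<lambda>n. 2 * n + d) ` (UNIV - E)"
  proof
    fix n assume n: "n \<in> UNIV - ?T"
    consider "even n" | "n < d" | "odd n" "d \<le> n" by linarith
    then show "n \<in> {..<d} \<union> (\<lambda>n. 2 * n) ` (UNIV - S) \<union> (\<lambda>n. 2 * n + d) ` (UNIV - E)"
    proof cases
      case 1
      then obtain k where k: "n = 2 * k" by (elim evenE)
      then have "k \<notin> S" using n by (auto simp: duplication_def)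
      then show ?thesis using k by blast
    next
      case 3
      then have "even (n - d)" using d by simp
      then obtain k where "n - d = 2 * k" by (elim evenE)
      then have k: "n = 2 * k + d" using 3 by simp
      then have "k \<notin> E" using n by (auto simp: duplication_def)
      then show ?thesis using k by blast
    qed simp
  qed
  then have "finite (UNIV - ?T)" by (rule finite_subset) (simp add: fS fE)
  moreover have "0 \<in> ?T" using S by (auto simp: duplication_def numerical_semigroup_def)
  moreover have "a + b \<in> ?T" if ab: "a \<in> ?T" "b \<in> ?T" for a b
  proof -
    have ES: "E \<subseteq> S" and SE: "\<And>s e. s \<in> S \<Longrightarrow> e \<in> E \<Longrightarrow> s + e \<in> E"
      using E by (auto simp: semigroup_ideal_def)
    have add: "\<And>s s'. s \<in> S \<Longrightarrow> s' \<in> S \<Longrightarrow> s + s' \<in> S"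
      using S by (auto simp: numerical_semigroup_def)
    have T: "2 * s \<in> ?T" if "s \<in> S" for s using that by (auto simp: duplication_def)
    have T': "2 * e + d \<in> ?T" if "e \<in> E" for e using that by (auto simp: duplication_def)
    consider (ss) s s' where "s \<in> S" "s' \<in> S" "a = 2 * s" "b = 2 * s'"
      | (se) s e where "s \<in> S" "e \<in> E" "a + b = 2 * s + (2 * e + d)"
      | (ee) e e' where "e \<in> E" "e' \<in> E" "a = 2 * e + d" "b = 2 * e' + d"
    proof -
      have "(\<exists>s\<in>S. x = 2 * s) \<or> (\<exists>e\<in>E. x = 2 * e + d)" if "x \<in> ?T" for x
        using that unfolding duplication_def by blast
      from this[OF ab(1)] this[OF ab(2)] show thesis
        using ss se ee by (metis add.commute)
    qed
    then show ?thesis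
    proof cases
      case ss then show ?thesis using T[OF add[of s s']] by simp
    next
      case se then show ?thesis using T'[OF SE[of s e]] by (simp add: algebra_simps)
    next
      case ee then show ?thesis using T[OF add[OF add[of e e'] d(1)]] ES
        by (auto simp: algebra_simps)
    qed
  qed
  ultimately show ?thesis by (simp add: numerical_semigroup_def)
qed

lemma finite_minimal_generators:
  assumes S: "numerical_semigroup S"
  shows "finite (minimal_generators S)"
proof -
  have fS: "finite (UNIV - S)" using S by (simp add: numerical_semigroup_def)
  have "infinite S"
  proof
    assume "finite S"
    with fS have "finite (UNIV - S \<union> S)" by (rule finite_UnI)
    then show False by simp
  qed
  then obtain m where m: "m \<in> S" "m > 0"
    unfolding infinite_nat_iff_unbounded by blast
  have "minimal_generators S \<subseteq> {..m} \<union> (\<lambda>n. n + m) ` (UNIV - S)"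
  proof
    fix n assume n: "n \<in> minimal_generators S"
    show "n \<in> {..m} \<union> (\<lambda>n. n + m) ` (UNIV - S)"
    proof (cases "n \<le> m")
      case False
      then have eq: "n = (n - m) + m" "n - m \<noteq> 0" by simp_all
      have "n \<noteq> a + m" if "a \<in> S - {0}" for a
        using n m that unfolding minimal_generators_def by blast
      from this[of "n - m"] have "n - m \<notin> S" using eq by auto
      then have "(n - m) + m \<in> (\<lambda>n. n + m) ` (UNIV - S)" by blast
      then show ?thesis using eq(1) by simp
    qed simp
  qed
  then show ?thesis by (rule finite_subset) (simp add: fS)
qed

lemma minimal_generators_generate:
  assumes S: "numerical_semigroup S" and "n \<in> S"
  shows "\<exists>\<alpha>. (\<forall>g. g \<notin> minimal_generators S \<longrightarrow> \<alpha> g = 0) \<and>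
              (\<Sum>g\<in>minimal_generators S. \<alpha> g * g) = n"
  using assms(2)
proof (induction n rule: less_induct)
  case (less n)
  let ?G = "minimal_generators S"
  have fG: "finite ?G" by (rule finite_minimal_generators[OF S])
  consider "n = 0" | "n \<in> ?G" | a b where "a \<in> S" "b \<in> S" "a \<noteq> 0" "b \<noteq> 0" "n = a + b"
    using less.prems unfolding minimal_generators_def by blast
  then show ?case
  proof cases
    case 1 then show ?thesis by (intro exI[of _ "\<lambda>_. 0"]) simp
  next
    case 2
    have "(\<Sum>g\<in>?G. (if g = n then 1 else 0) * g) = (\<Sum>g\<in>?G. if g = n then n else 0)"
      by (rule sum.cong) auto
    then show ?thesis using 2 fG by (intro exI[of _ "\<lambda>g. if g = n then 1 else 0"]) auto
  next
    case 3
    obtain \<alpha> \<beta> where "\<forall>g. g \<notin> ?G \<longrightarrow> \<alpha> g = 0" "(\<Sum>g\<in>?G. \<alpha> g * g) = a"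
      "\<forall>g. g \<notin> ?G \<longrightarrow> \<beta> g = 0" "(\<Sum>g\<in>?G. \<beta> g * g) = b"
      using less.IH[of a] less.IH[of b] 3 by auto
    then show ?thesis using 3
      by (intro exI[of _ "\<lambda>g. \<alpha> g + \<beta> g"]) (simp add: algebra_simps sum.distrib)
  qed
qed

lemma semigroup_ring_eq:
  assumes S: "numerical_semigroup S"
  shows "(semigroup_ring S :: 'k::field fls set) =
           fps_to_fls ` {f. \<forall>n. n \<notin> S \<longrightarrow> fps_nth f n = 0}"
proof -
  let ?G = "minimal_generators S"
  let ?A = "\<lambda>j. {\<alpha>. (\<forall>g. g \<notin> ?G \<longrightarrow> \<alpha> g = 0) \<and> (\<Sum>g\<in>?G. \<alpha> g * g) = j}"
  have fG: "finite ?G" by (rule finite_minimal_generators[OF S])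
  have GS: "?G \<subseteq> S" and G0: "0 \<notin> ?G" by (auto simp: minimal_generators_def)
  have add: "\<And>s s'. s \<in> S \<Longrightarrow> s' \<in> S \<Longrightarrow> s + s' \<in> S" and zero: "0 \<in> S"
    using S by (auto simp: numerical_semigroup_def)
  have mult: "a * g \<in> S" if "g \<in> S" for a g :: nat
    by (induction a) (use that add zero in auto)
  have inS: "(\<Sum>g\<in>F. \<alpha> g * g) \<in> S" if "finite F" "F \<subseteq> S" for F and \<alpha> :: "nat \<Rightarrow> nat"
    using that by (induction F) (auto simp: zero add mult)
  have empty: "?A j = {}" if "j \<notin> S" for j using inS[OF fG GS] that by auto
  have finA: "finite (?A j)" for j
  proof (rule finite_subset)
    show "?A j \<subseteq> {\<alpha>. \<forall>g. (g \<in> ?G \<longrightarrow> \<alpha> g \<in> {..j}) \<and> (g \<notin> ?G \<longrightarrow> \<alpha> g = 0)}"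
    proof (clarsimp)
      fix \<alpha> :: "nat \<Rightarrow> nat" and g assume g: "g \<in> ?G"
      then have "\<alpha> g \<le> \<alpha> g * g" using G0 by (cases g) auto
      also have "\<dots> \<le> (\<Sum>g\<in>?G. \<alpha> g * g)" by (rule member_le_sum) (use g fG in auto)
      finally show "\<alpha> g \<le> (\<Sum>g\<in>?G. \<alpha> g * g)" .
    qed
    show "finite {\<alpha>::nat\<Rightarrow>nat. \<forall>g. (g \<in> ?G \<longrightarrow> \<alpha> g \<in> {..j}) \<and> (g \<notin> ?G \<longrightarrow> \<alpha> g = 0)}"
      by (rule finite_set_of_finite_funs[OF fG]) simp
  qed
  have "(gen_power_series ?G :: 'k fps set) = {f. \<forall>n. n \<notin> S \<longrightarrow> fps_nth f n = 0}" (is "_ = ?R")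
  proof
    show "gen_power_series ?G \<subseteq> ?R"
    proof
      fix f :: "'k fps" assume "f \<in> gen_power_series ?G"
      then obtain c where "f = Abs_fps (\<lambda>j. \<Sum>\<alpha>\<in>?A j. c \<alpha>)"
        unfolding gen_power_series_def by blast
      then have "fps_nth f n = 0" if "n \<notin> S" for n by (simp only: fps_nth_Abs_fps empty[OF that] sum.empty)
      then show "f \<in> ?R" by blast
    qed
  next
    show "?R \<subseteq> gen_power_series ?G"
    proof
      fix f :: "'k fps" assume f: "f \<in> ?R"
      define rep where "rep j = (SOME \<alpha>. \<alpha> \<in> ?A j)" for j
      have rep: "rep j \<in> ?A j" if "j \<in> S" for j
    proof -
        have "\<exists>\<alpha>. \<alpha> \<in> ?A j" using minimal_generators_generate[OF S that] by blast
        then show ?thesis unfolding rep_def by (rule someI_ex)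
      qed
      define c where "c \<alpha> = (let j = \<Sum>g\<in>?G. \<alpha> g * g in if \<alpha> = rep j then fps_nth f j else 0)"
        for \<alpha>
      have "(\<Sum>\<alpha>\<in>?A j. c \<alpha>) = fps_nth f j" for j
      proof (cases "j \<in> S")
        case True
        have "(\<Sum>\<alpha>\<in>?A j. c \<alpha>) = (\<Sum>\<alpha>\<in>?A j. if \<alpha> = rep j then fps_nth f j else 0)"
          proof (rule sum.cong[OF refl])
          fix \<alpha> assume "\<alpha> \<in> ?A j"
          then have "(\<Sum>g\<in>?G. \<alpha> g * g) = j" by blast
          then show "c \<alpha> = (if \<alpha> = rep j then fps_nth f j else 0)"
            by (simp only: c_def Let_def)
        qed
        also have "\<dots> = fps_nth f j" using rep[OF True] by (simp only: sum.delta[OF finA] if_True)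
        finally show ?thesis .
      next
        case False
        then show ?thesis using f unfolding empty[OF False] by simp
      qed
      then have "f = Abs_fps (\<lambda>j. \<Sum>\<alpha>\<in>?A j. c \<alpha>)" by (simp add: fps_eq_iff)
      then show "f \<in> gen_power_series ?G" unfolding gen_power_series_def by blast
    qed
  qed
  then show ?thesis by (simp add: semigroup_ring_def)
qed

end

theory Submission
  imports Defs
begin

text \<open>
  Write \<open>F\<close> and \<open>m\<close> for the Frobenius number and the multiplicity of \<open>S\<close>, and \<open>T\<close> for the
  duplication. All rings in question are spaces of Laurent series with coefficients prescribed
  to vanish outside a set of exponents, so their invariants are numbers of exponents
  (\<open>quot_dim_eq_card\<close>). The conductor of \<open>k[[S]]\<close> consists of the series of order greater than
  \<open>F\<close>, whence minimal reduced type means that \<open>F\<close> is the only gap of \<open>S\<close> in the interval from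
  \<open>F - m + 1\<close> to \<open>F\<close> (\<open>minimal_reduced_type_iff\<close>); the socle of \<open>k[[S]] / (t\<^sup>m)\<close> is spanned by the
  \<open>t\<^bsup>m + f\<^esup>\<close> with \<open>f\<close> pseudo-Frobenius, whence Gorenstein means that \<open>F\<close> is the only
  pseudo-Frobenius number (\<open>gorenstein_iff\<close>).

  What remains concerns integers. For \<open>E = S\<close>, the interval of \<open>T\<close> lies above \<open>2 F\<close> and its odd
  elements come from the interval of \<open>S\<close>. For the other ideals, let \<open>g\<close> be the largest integer outside \<open>E\<close> and suppose
  \<open>0 \<notin> E\<close>. Then \<open>T\<close> has Frobenius number \<open>2 g + d\<close> and multiplicity \<open>2 m\<close>. Reading the condition on
  \<open>T\<close> separately for odd and for even integers shows that \<open>T\<close> has minimal reduced type iff no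
  integer strictly between \<open>g - m\<close> and \<open>g\<close> is missing from \<open>E\<close> and \<open>2 F\<close> lies below the
  interval, i.e. \<open>2 (F - g + m) < d\<close> (\<open>minimal_reduced_type_T_iff\<close>). If \<open>F < g\<close> and \<open>E \<union> {0}\<close> has
  minimal reduced type, then \<open>F \<le> g - m\<close> and the second condition holds for any \<open>d\<close>.

  If \<open>F = g\<close>, the second condition reads \<open>2 m < d\<close>. Here \<open>2 F\<close> is a pseudo-Frobenius number of \<open>T\<close>,
  so \<open>max PF'(T)\<close> is at least \<open>2 F\<close>, and it is larger only because of an odd pseudo-Frobenius
  number \<open>2 j + d\<close> with \<open>j \<notin> E\<close>. In that case minimal reduced type of \<open>E \<union> {0}\<close> bounds \<open>j\<close> from above
  and therefore \<open>d\<close> from below. If instead \<open>max PF'(T) = 2 F\<close>, then \<open>2 m < d\<close> alone implies the first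
  condition: above every \<open>j \<notin> E\<close> there is some \<open>f \<notin> E\<close> such that \<open>f - j \<in> S\<close> and \<open>2 f + d\<close> is
  pseudo-Frobenius (\<open>maximal_gap_above\<close>), and this number would exceed \<open>2 F\<close>. The same
  argument for \<open>S\<close> in place of \<open>E\<close> shows that a Gorenstein \<open>S\<close> has minimal reduced type.

  It remains to keep \<open>0\<close>, which is in \<open>E \<union> {0}\<close> but not in \<open>E\<close>, out of the interval between \<open>g - m\<close>
  and \<open>g\<close>. If \<open>F < g\<close>, then \<open>g \<in> S\<close> and so \<open>m \<le> g\<close>. If \<open>F = g\<close> and \<open>E \<union> {0}\<close> has minimal reduced type,
  then the only exception is the case that \<open>E \<union> {0}\<close> is the semigroup with the single gap \<open>1\<close>. That
  semigroup is Gorenstein, and the exception forces \<open>E = S - {0}\<close>. For Gorenstein \<open>S\<close> and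
  \<open>E = S - {0}\<close>, the requirement is \<open>m < F + 1\<close>.
\<close>

section \<open>Laurent series with prescribed support\<close>

text \<open>
  Exponents are integers, not natural numbers, so that pseudo-Frobenius numbers and the shift by
  a multiplicity can be treated without truncated subtraction.
\<close>
definition series_on :: "int set \<Rightarrow> 'k::field fls set" where
  "series_on A = {z. \<forall>n. n \<notin> A \<longrightarrow> fls_nth z n = 0}"

lemma series_onI: "(\<And>n. n \<notin> A \<Longrightarrow> fls_nth z n = 0) \<Longrightarrow> z \<in> series_on A"
  by (simp add: series_on_def)

lemma series_onD: "z \<in> series_on A \<Longrightarrow> n \<notin> A \<Longrightarrow> fls_nth z n = 0"
  by (simp add: series_on_def)

lemma series_on_mono: "A \<subseteq> B \<Longrightarrow> series_on A \<subseteq> series_on B"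
  by (auto simp: series_on_def)

lemma series_on_add: "y \<in> series_on A \<Longrightarrow> z \<in> series_on A \<Longrightarrow> y + z \<in> series_on A"
  by (auto simp: series_on_def)

lemma series_on_uminus: "z \<in> series_on A \<Longrightarrow> - z \<in> series_on A"
  by (auto simp: series_on_def)

lemma series_on_sum: "(\<And>i. i \<in> I \<Longrightarrow> f i \<in> series_on A) \<Longrightarrow> sum f I \<in> series_on A"
  by (auto simp: series_on_def fls_nth_sum)

lemma series_on_mult:
  assumes "f \<in> series_on A" "g \<in> series_on B" "\<And>a b. a \<in> A \<Longrightarrow> b \<in> B \<Longrightarrow> a + b \<in> C"
  shows "f * g \<in> series_on C"
proof (rule series_onI)
  fix n assume n: "n \<notin> C"
  have "fls_nth f i * fls_nth g (n - i) = 0" for i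
  proof (cases "i \<in> A \<and> n - i \<in> B")
    case True
    then show ?thesis using assms(3)[of i "n - i"] n by simp
  next
    case False
    then show ?thesis using assms(1,2) by (auto simp: series_on_def)
  qed
  then show "fls_nth (f * g) n = 0"
    unfolding fls_times_nth(2) by (intro sum.neutral ballI)
qed

lemma fls_X_intpow_in_series_on: "n \<in> A \<Longrightarrow> fls_X_intpow n \<in> series_on A"
  by (auto simp: series_on_def)

lemma one_in_series_on: "0 \<in> A \<Longrightarrow> 1 \<in> series_on A"
  by (auto simp: series_on_def)

lemma principal_series_on:
  "principal (fls_X ^ m) (series_on A :: 'a::field fls set) = series_on ((+) (int m) ` A)"
proof
  show "(principal (fls_X ^ m) (series_on A) :: 'a fls set) \<subseteq> series_on ((+) (int m) ` A)"
  proof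
    fix z :: "'a fls" assume "z \<in> principal (fls_X ^ m) (series_on A)"
    then obtain r where r: "r \<in> series_on A" and z: "z = fls_shift (- int m) r"
      by (auto simp: principal_def fls_X_power_times_conv_shift)
    show "z \<in> series_on ((+) (int m) ` A)"
    proof (rule series_onI)
      fix n assume "n \<notin> (+) (int m) ` A"
      then have "n - int m \<notin> A" by (metis add_diff_cancel_left' diff_add_cancel image_eqI add.commute)
      then show "fls_nth z n = 0" using r by (simp add: z series_on_def)
    qed
  qed
  show "series_on ((+) (int m) ` A) \<subseteq> (principal (fls_X ^ m) (series_on A) :: 'a fls set)"
  proof
    fix z :: "'a fls" assume z: "z \<in> series_on ((+) (int m) ` A)"
    have "z = fls_X ^ m * fls_shift (int m) z"
      by (simp add: fls_X_power_times_conv_shift)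
    moreover have "fls_shift (int m) z \<in> series_on A"
    proof (rule series_onI)
      fix n assume "n \<notin> A"
      then have "n + int m \<notin> (+) (int m) ` A" by (auto simp: add.commute)
      then show "fls_nth (fls_shift (int m) z) n = 0" using z by (simp add: series_on_def)
    qed
    ultimately show "z \<in> principal (fls_X ^ m) (series_on A)"
      unfolding principal_def by blast
  qed
qed

section \<open>Dimensions of quotients\<close>

text \<open>
  The dimension of \<open>V / W\<close> is well defined. The coordinates of \<open>b \<in> B\<close> with respect to \<open>B'\<close> give a
  vector congruent to \<open>b\<close> modulo \<open>W\<close>; these vectors are linearly independent because \<open>0\<close>
  is congruent to only one linear combination of \<open>B\<close>, and they lie in the span of \<open>B'\<close>.
\<close>
lemma quot_basis_card_le:
  fixes V :: "'k::field fls set"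
  assumes B: "quot_basis V W B" and B': "quot_basis V W B'"
    and add: "\<And>y z. y \<in> W \<Longrightarrow> z \<in> W \<Longrightarrow> y + z \<in> W"
    and scale: "\<And>a z. z \<in> W \<Longrightarrow> fls_const a * z \<in> W"
    and zeroV: "0 \<in> V" and zeroW: "0 \<in> W"
  shows "card B \<le> card B'"
proof -
  interpret vector_space "\<lambda>a (z :: 'k fls). fls_const a * z"
    by unfold_locales (auto simp: algebra_simps simp flip: fls_plus_const fls_const_mult_const)
  have fin: "finite B" "finite B'" "B \<subseteq> V"
    using B B' by (auto simp: quot_basis_def)
  have sumW: "sum f I \<in> W" if "\<And>i. i \<in> I \<Longrightarrow> f i \<in> W" for f :: "'k fls \<Rightarrow> 'k fls" and I
    using that by (induction I rule: infinite_finite_induct) (auto intro: add zeroW)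
  have "\<forall>b\<in>B. \<exists>c. b - (\<Sum>e\<in>B'. fls_const (c e) * e) \<in> W"
    using B' fin unfolding quot_basis_def by blast
  then obtain c where c: "\<And>b. b \<in> B \<Longrightarrow> b - (\<Sum>e\<in>B'. fls_const (c b e) * e) \<in> W"
    by metis
  define P where "P b = (\<Sum>e\<in>B'. fls_const (c b e) * e)" for b
  have indep: "a b = 0" if 0: "(\<Sum>b\<in>B. fls_const (a b) * P b) = 0" and b: "b \<in> B" for a b
  proof -
    have "(\<Sum>b\<in>B. fls_const (- a b) * (b - P b)) \<in> W"
      by (rule sumW, rule scale) (use c in \<open>auto simp: P_def\<close>)
    also have "(\<Sum>b\<in>B. fls_const (- a b) * (b - P b)) = 0 - (\<Sum>b\<in>B. fls_const (a b) * b)"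
      using 0 by (simp add: algebra_simps sum.distrib sum_negf sum_subtractf)
    finally have W: "0 - (\<Sum>b\<in>B. fls_const (if b \<in> B then a b else 0) * b) \<in> W"
      by (simp cong: sum.cong)
    define Q where "Q c \<longleftrightarrow> (\<forall>b. b \<notin> B \<longrightarrow> c b = 0) \<and> 0 - (\<Sum>b\<in>B. fls_const (c b) * b) \<in> W" for c
    have "\<exists>!c. Q c"
      using B zeroV unfolding quot_basis_def Q_def by blast
    moreover have "Q (\<lambda>_. 0)"
      using zeroW by (simp add: Q_def)
    moreover have "Q (\<lambda>b. if b \<in> B then a b else 0)"
      unfolding Q_def using W by simp
    ultimately have "(\<lambda>b. if b \<in> B then a b else 0) = (\<lambda>_. 0)"
      by blast
    then show "a b = 0" using b by meson
  qed
  have inj: "inj_on P B"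
  proof (rule inj_onI, rule ccontr)
    fix b b' assume b: "b \<in> B" "b' \<in> B" "P b = P b'" "b \<noteq> b'"
    let ?a = "\<lambda>x. if x = b then 1 else if x = b' then -1 else (0::'k)"
    have "(\<Sum>x\<in>B. fls_const (?a x) * P x) = (\<Sum>x\<in>{b, b'}. fls_const (?a x) * P x)"
      by (rule sum.mono_neutral_right) (use b fin in auto)
    also have "\<dots> = 0" using b by simp
    finally show False using indep[of ?a b] b by simp
  qed
  have "independent (P ` B)"
  proof (rule independent_if_scalars_zero)
    fix f x assume "(\<Sum>x\<in>P ` B. fls_const (f x) * x) = 0" "x \<in> P ` B"
    then show "f x = 0"
      using indep[of "f \<circ> P"] by (auto simp: sum.reindex[OF inj])
  qed (simp add: fin)
  moreover have "P ` B \<subseteq> span B'"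
    unfolding P_def by (auto intro: span_sum span_scale span_base)
  ultimately have "card (P ` B) \<le> card B'"
    using independent_span_bound fin by blast
  then show ?thesis by (simp add: card_image[OF inj])
qed

text \<open>
  Modulo the series supported on \<open>B\<close>, only the coefficients at the finitely many exponents in \<open>D\<close>
  survive, so the monomials with exponent in \<open>D\<close> form a basis.
\<close>
lemma quot_dim_eq_card:
  fixes V :: "'k::field fls set"
  assumes D: "finite D" "D \<inter> B = {}" and V: "V \<subseteq> series_on (D \<union> B)"
    and mon: "\<And>n. n \<in> D \<Longrightarrow> fls_X_intpow n \<in> V" and zero: "0 \<in> V"
  shows "quot_dim V (series_on B) = card D"
proof -
  let ?W = "series_on B :: 'k fls set" and ?t = "fls_X_intpow :: int \<Rightarrow> 'k fls"
  have inj: "inj_on ?t D"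
    by (rule inj_on_inverseI[of _ fls_subdegree]) simp
  have nth: "fls_nth (\<Sum>b\<in>?t ` D. fls_const (c b) * b) n = (if n \<in> D then c (?t n) else 0)"
    for c n
  proof -
    have "fls_nth (\<Sum>b\<in>?t ` D. fls_const (c b) * b) n
            = (\<Sum>i\<in>D. if i = n then c (?t i) else 0)"
      unfolding sum.reindex[OF inj] fls_nth_sum
      by (rule sum.cong) auto
    then show ?thesis using D by simp
  qed
  have basis: "quot_basis V ?W (?t ` D)"
    unfolding quot_basis_def
  proof (intro conjI ballI)
    fix v assume v: "v \<in> V"
    show "\<exists>!c. (\<forall>b. b \<notin> ?t ` D \<longrightarrow> c b = 0) \<and> v - (\<Sum>b\<in>?t ` D. fls_const (c b) * b) \<in> ?W"
    proof (rule ex1I)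
      let ?c = "\<lambda>b. if b \<in> ?t ` D then fls_nth v (fls_subdegree b) else 0"
      have "v - (\<Sum>b\<in>?t ` D. fls_const (?c b) * b) \<in> ?W"
      proof (rule series_onI)
        fix n assume n: "n \<notin> B"
        show "fls_nth (v - (\<Sum>b\<in>?t ` D. fls_const (?c b) * b)) n = 0"
        proof (cases "n \<in> D")
          case True
          then show ?thesis by (simp add: nth)
        next
          case False
          then show ?thesis using series_onD[of v "D \<union> B" n] v V n by (auto simp: nth)
        qed
      qed
      then show "(\<forall>b. b \<notin> ?t ` D \<longrightarrow> ?c b = 0) \<and> v - (\<Sum>b\<in>?t ` D. fls_const (?c b) * b) \<in> ?W"
        by simp
      fix c assume c: "(\<forall>b. b \<notin> ?t ` D \<longrightarrow> c b = 0) \<and> v - (\<Sum>b\<in>?t ` D. fls_const (c b) * b) \<in> ?W"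
      show "c = ?c"
      proof
        fix b show "c b = ?c b"
        proof (cases "b \<in> ?t ` D")
          case True
          then obtain n where n: "n \<in> D" "b = ?t n" by blast
          then have "n \<notin> B" using D by blast
          then have "fls_nth (v - (\<Sum>b\<in>?t ` D. fls_const (c b) * b)) n = 0"
            using c by (blast intro: series_onD)
          then show ?thesis using n by (simp add: nth)
        qed (use c in simp)
      qed
    qed
  qed (use D mon in auto)
  have W: "\<And>y z. y \<in> ?W \<Longrightarrow> z \<in> ?W \<Longrightarrow> y + z \<in> ?W" "\<And>a z. z \<in> ?W \<Longrightarrow> fls_const a * z \<in> ?W" "0 \<in> ?W"
    by (auto simp: series_on_def)
  have "quot_basis V ?W (SOME B. quot_basis V ?W B)"
    using basis by (rule someI)
  then have "card (SOME B. quot_basis V ?W B) = card (?t ` D)"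
    by (intro antisym quot_basis_card_le[OF _ basis] quot_basis_card_le[OF basis])
       (use W zero in auto)
  then show ?thesis
    using basis by (auto simp: quot_dim_def card_image[OF inj])
qed

section \<open>Gaps and pseudo-Frobenius numbers\<close>

lemma frobenius_notin:
  assumes "numerical_semigroup S"
  shows "frobenius S \<notin> int ` S"
proof (cases "S = UNIV")
  case False
  then have "Max (UNIV - S) \<in> UNIV - S"
    using assms by (intro Max_in) (auto simp: numerical_semigroup_def)
  then show ?thesis using False by (auto simp: frobenius_def)
qed (auto simp: frobenius_def)

lemma in_if_gt_frobenius:
  assumes "numerical_semigroup S" "frobenius S < n"
  shows "n \<in> int ` S"
proof -
  have ge: "0 \<le> n" using assms(2) by (simp add: frobenius_def split: if_splits)
  have "nat n \<in> S"
  proof (rule ccontr)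
    assume n: "nat n \<notin> S"
    then have "nat n \<le> Max (UNIV - S)"
      using assms(1) by (intro Max_ge) (auto simp: numerical_semigroup_def)
    moreover have "S \<noteq> UNIV" using n by auto
    ultimately show False using assms(2) ge by (simp add: frobenius_def nat_le_iff)
  qed
  then show ?thesis using ge by (metis image_eqI int_nat_eq)
qed

text \<open>
  This characterization also covers the convention for the semigroup without gaps.
\<close>
lemma frobenius_eqI:
  assumes S: "numerical_semigroup S" and "f \<notin> int ` S" "\<And>n. f < n \<Longrightarrow> n \<in> int ` S"
  shows "frobenius S = f"
  using frobenius_notin[OF S] in_if_gt_frobenius[OF S, of f] assms(2,3)
  by (cases "frobenius S" f rule: linorder_cases) auto

lemma sg_mult_in:
  assumes "numerical_semigroup S"
  shows "sg_mult S \<in> S" and "0 < sg_mult S"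
proof -
  have "frobenius S < \<bar>frobenius S\<bar> + 1" by linarith
  then obtain n where "n \<in> S" "int n = \<bar>frobenius S\<bar> + 1"
    using in_if_gt_frobenius[OF assms] by (metis imageE)
  then have "n \<in> S \<and> n \<noteq> 0" by auto
  then have "sg_mult S \<in> S \<and> sg_mult S \<noteq> 0"
    unfolding sg_mult_def by (rule LeastI)
  then show "sg_mult S \<in> S" "0 < sg_mult S" by auto
qed

lemma sg_mult_le: "s \<in> S \<Longrightarrow> s \<noteq> 0 \<Longrightarrow> sg_mult S \<le> s"
  unfolding sg_mult_def by (rule Least_le) simp

lemma sg_mult_le_int: "z \<in> int ` S \<Longrightarrow> z \<noteq> 0 \<Longrightarrow> int (sg_mult S) \<le> z"
  using sg_mult_le by auto

lemma int_add_in: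
  "numerical_semigroup S \<Longrightarrow> a \<in> int ` S \<Longrightarrow> b \<in> int ` S \<Longrightarrow> a + b \<in> int ` S"
  by (auto simp: numerical_semigroup_def simp flip: of_nat_add)

lemma frobenius_pos:
  assumes "numerical_semigroup S" "S \<noteq> UNIV"
  shows "1 \<le> frobenius S"
proof -
  have "frobenius S \<noteq> 0"
    using frobenius_notin[OF assms(1)] assms by (auto simp: numerical_semigroup_def)
  then show ?thesis using assms by (simp add: frobenius_def)
qed

lemma frobenius_ge: "-1 \<le> frobenius S"
  by (simp add: frobenius_def)

lemma pseudo_frobenius_bounds:
  assumes S: "numerical_semigroup S" and "f \<in> pseudo_frobenius S"
  shows "- int (sg_mult S) \<le> f" "f \<le> frobenius S"
proof -
  have "f + int (sg_mult S) \<in> int ` S"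
    using assms sg_mult_in[OF S] by (auto simp: pseudo_frobenius_def)
  then show "- int (sg_mult S) \<le> f" by auto
  have "f \<notin> int ` S" using assms(2) by (simp add: pseudo_frobenius_def)
  then show "f \<le> frobenius S" using in_if_gt_frobenius[OF S, of f] by linarith
qed

lemma finite_pseudo_frobenius:
  assumes "numerical_semigroup S"
  shows "finite (pseudo_frobenius S)"
proof (rule finite_subset)
  show "pseudo_frobenius S \<subseteq> {- int (sg_mult S)..frobenius S}"
    using pseudo_frobenius_bounds[OF assms] by auto
qed simp

lemma frobenius_in_pseudo_frobenius:
  assumes "numerical_semigroup S"
  shows "frobenius S \<in> pseudo_frobenius S"
proof -
  have "frobenius S + int s \<in> int ` S" if "s \<in> S - {0}" for s
    by (rule in_if_gt_frobenius[OF assms]) (use that in simp)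
  then show ?thesis
    using frobenius_notin[OF assms] unfolding pseudo_frobenius_def by blast
qed

lemma card_pseudo_frobenius_eq_1_iff:
  assumes "numerical_semigroup S"
  shows "card (pseudo_frobenius S) = 1 \<longleftrightarrow> pseudo_frobenius S = {frobenius S}"
  using frobenius_in_pseudo_frobenius[OF assms] by (auto simp: card_1_singleton_iff)

text \<open>
  The largest element of \<open>j + S\<close> outside \<open>E\<close>: adding a nonzero element of \<open>S\<close> to it stays in
  \<open>j + S\<close>, hence leads into \<open>E\<close>. With \<open>E = S\<close> it is a pseudo-Frobenius number of \<open>S\<close>.
\<close>
lemma maximal_gap_above:
  assumes gt: "\<And>n. g < n \<Longrightarrow> n \<in> int ` E" and S: "numerical_semigroup S"
    and j: "j \<notin> int ` E"
  obtains f where "f \<notin> int ` E" "f - j \<in> int ` S" "\<And>s. s \<in> S - {0} \<Longrightarrow> f + int s \<in> int ` E"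
proof -
  let ?A = "{f. f \<notin> int ` E \<and> f - j \<in> int ` S}"
  have "?A \<subseteq> {j..g}"
  proof
    fix f assume f: "f \<in> ?A"
    then have "f \<le> g" using gt[of f] by (intro leI) blast
    moreover have "j \<le> f" using f by auto
    ultimately show "f \<in> {j..g}" by simp
  qed
  then have fin: "finite ?A" by (rule finite_subset) simp
  have "j - j \<in> int ` S" using S by (simp add: numerical_semigroup_def)
  then have "j \<in> ?A" using j by blast
  then have Max: "Max ?A \<in> ?A" using fin by (intro Max_in) auto
  show thesis
  proof (rule that)
    fix s assume s: "s \<in> S - {0}"
    show "Max ?A + int s \<in> int ` E"
    proof (rule ccontr)
      assume "Max ?A + int s \<notin> int ` E"
      moreover have "Max ?A + int s - j \<in> int ` S"
        using int_add_in[OF S, of "Max ?A - j" "int s"] Max s by (auto simp: algebra_simps)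
      ultimately have "Max ?A + int s \<le> Max ?A" using fin by (intro Max_ge) auto
      then show False using s by simp
    qed
  qed (use Max in auto)
qed

section \<open>The ring invariants of a numerical semigroup\<close>

lemma semigroup_ring_eq_series_on:
  assumes "numerical_semigroup S"
  shows "semigroup_ring S = (series_on (int ` S) :: 'k::field fls set)"
  unfolding semigroup_ring_eq[OF assms]
proof
  show "fps_to_fls ` {f. \<forall>n. n \<notin> S \<longrightarrow> fps_nth f n = 0} \<subseteq> (series_on (int ` S) :: 'k fls set)"
    by (force intro!: series_onI)
  show "(series_on (int ` S) :: 'k fls set) \<subseteq> fps_to_fls ` {f. \<forall>n. n \<notin> S \<longrightarrow> fps_nth f n = 0}"
  proof
    fix z :: "'k fls" assume z: "z \<in> series_on (int ` S)"
    have "z = fps_to_fls (fls_regpart z)"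
    proof (rule fls_eqI)
      fix n show "fls_nth z n = fls_nth (fps_to_fls (fls_regpart z)) n"
      proof (cases "n < 0")
        case True
        then have "n \<notin> int ` S" by auto
        then show ?thesis using series_onD[OF z] True by simp
      qed simp
    qed
    moreover have "fps_nth (fls_regpart z) n = 0" if "n \<notin> S" for n
    proof -
      have "int n \<notin> int ` S" using that by auto
      then show ?thesis using series_onD[OF z] by simp
    qed
    ultimately show "z \<in> fps_to_fls ` {f. \<forall>n. n \<notin> S \<longrightarrow> fps_nth f n = 0}" by blast
  qed
qed

lemma fls_X_power_in_series_on: "int n \<in> A \<Longrightarrow> fls_X ^ n \<in> series_on A"
  by (auto simp: series_on_def)

text \<open>
  Since \<open>S\<close> contains all large integers, a high power of \<open>t\<close> lies in \<open>k[[S]]\<close> and moves any Laurent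
  series into \<open>k[[S]]\<close>.
\<close>
lemma quotient_field_semigroup_ring:
  assumes S: "numerical_semigroup S"
  shows "quotient_field (series_on (int ` S) :: 'k::field fls set) = UNIV"
proof (intro equalityI subset_UNIV subsetI)
  fix z :: "'k fls"
  define N where "N = nat (\<bar>frobenius S\<bar> + 1 + \<bar>fls_subdegree z\<bar>)"
  have N: "frobenius S < int N" "frobenius S < int N + fls_subdegree z"
    by (auto simp: N_def)
  have "fls_X ^ N * z \<in> series_on (int ` S)"
  proof (rule series_onI)
    fix n assume "n \<notin> int ` S"
    then have "n \<le> frobenius S" using in_if_gt_frobenius[OF S, of n] by linarith
    then have "n - int N < fls_subdegree z" using N by linarith
    then show "fls_nth (fls_X ^ N * z) n = 0" by (simp add: fls_X_power_times_conv_shift)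
  qed
  moreover have "fls_X ^ N \<in> (series_on (int ` S) :: 'k fls set)"
    by (intro fls_X_power_in_series_on in_if_gt_frobenius[OF S] N)
  moreover have "fls_X ^ N \<noteq> (0 :: 'k fls)" by simp
  moreover from this have "z = fls_X ^ N * z / fls_X ^ N" by (rule nonzero_mult_div_cancel_left[symmetric])
  ultimately show "z \<in> quotient_field (series_on (int ` S))"
    unfolding quotient_field_def by blast
qed

text \<open>
  For \<open>n > F\<close>, the monomial \<open>t\<^sup>j\<close> is a root of \<open>X\<^sup>n - t\<^bsup>jn\<^esup>\<close>, whose coefficients are in \<open>k[[S]]\<close>.
\<close>
lemma fls_X_power_in_integral_closure:
  assumes S: "numerical_semigroup S"
  shows "fls_X ^ j \<in> integral_closure (series_on (int ` S) :: 'k::field fls set)"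
proof -
  let ?R = "series_on (int ` S) :: 'k fls set"
  \<comment> \<open>The summand 2 makes n positive even if F = -1.\<close>
  define n where "n = nat (frobenius S + 2)"
  have n: "frobenius S < int n" "0 < n" using frobenius_ge[of S] by (auto simp: n_def)
  have zero: "0 \<in> S" using S by (simp add: numerical_semigroup_def)
  have "int (j * n) \<in> int ` S"
  proof (cases "j = 0")
    case False
    then have "n \<le> j * n" by (cases j) auto
    then show ?thesis using n by (intro in_if_gt_frobenius[OF S]) linarith
  qed (use zero in simp)
  then have c: "- (fls_X ^ (j * n)) \<in> ?R"
    by (intro series_on_uminus fls_X_power_in_series_on)
  define p :: "'k fls poly" where "p = [:- (fls_X ^ (j * n)):] + monom 1 n"
  have "lead_coeff p = 1"
    unfolding p_def using n by (subst lead_coeff_add_le) (auto simp: degree_monom_eq)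
  moreover have "coeff p i \<in> ?R" for i
  proof -
    have "coeff [:- (fls_X ^ (j * n)):] i \<in> ?R"
      using c by (cases i) (auto simp: series_on_def)
    moreover have "coeff (monom 1 n) i \<in> ?R"
      using zero by (auto simp: series_on_def)
    ultimately show ?thesis unfolding p_def coeff_add by (rule series_on_add)
  qed
  moreover have "poly p (fls_X ^ j) = 0"
    by (simp add: p_def poly_monom power_mult)
  ultimately show ?thesis
    unfolding integral_closure_def quotient_field_semigroup_ring[OF S] by blast
qed

text \<open>
  Integral closedness of \<open>k[[t]]\<close>: if \<open>y\<close> is not a power series, then \<open>w = 1/y\<close> is one. For a monic
  equation of degree \<open>n + 1\<close>, multiplication by \<open>w\<^sup>n\<close> expresses \<open>y\<close> as a polynomial in \<open>w\<close> with power
  series coefficients.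
\<close>
lemma integral_over_power_series:
  fixes y :: "'k::field fls"
  assumes lead: "lead_coeff p = 1" and coeff: "\<And>i. coeff p i \<in> series_on {0..}" and root: "poly p y = 0"
  shows "y \<in> series_on {0..}"
proof (cases "0 \<le> fls_subdegree y")
  case True
  then show ?thesis by (intro series_onI) auto
next
  case False
  define w where "w = inverse y"
  have y: "y \<noteq> 0" using False by auto
  have "0 \<le> fls_subdegree w" using False by (simp add: w_def)
  then have w: "w \<in> series_on {0..}" by (intro series_onI) auto
  have mult: "f * g \<in> series_on {0..}" if "f \<in> series_on {0..}" "g \<in> series_on {0..}" for f g :: "'k fls"
    using that by (rule series_on_mult) auto
  have w_power: "w ^ i \<in> series_on {0..}" for i
    by (induction i) (auto intro: mult w one_in_series_on)
  have "degree p \<noteq> 0"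
  proof
    assume "degree p = 0"
    then obtain a where "p = [:a:]" by (rule degree_eq_zeroE)
    then show False using lead root by simp
  qed
  then obtain n where n: "degree p = Suc n" by (cases "degree p") auto
  have "y ^ i * w ^ n = w ^ (n - i)" if "i \<le> n" for i
  proof -
    have "w ^ n = w ^ i * w ^ (n - i)" using that by (simp flip: power_add)
    then show ?thesis using y by (simp add: w_def power_inverse)
  qed
  then have eq: "(\<Sum>i\<le>n. coeff p i * y ^ i) * w ^ n = (\<Sum>i\<le>n. coeff p i * w ^ (n - i))"
    by (simp add: sum_distrib_right mult.assoc)
  have "0 = poly p y * w ^ n" using root by simp
  also have "\<dots> = (\<Sum>i\<le>n. coeff p i * y ^ i) * w ^ n + y ^ Suc n * w ^ n"
    using lead n by (simp add: poly_altdef algebra_simps)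
  also have "y ^ Suc n * w ^ n = y" using y by (simp add: w_def power_inverse)
  finally have "y = - (\<Sum>i\<le>n. coeff p i * w ^ (n - i))"
    unfolding eq by (simp add: eq_neg_iff_add_eq_0 add.commute)
  moreover have "- (\<Sum>i\<le>n. coeff p i * w ^ (n - i)) \<in> series_on {0..}"
    by (intro series_on_uminus series_on_sum mult coeff w_power)
  ultimately show ?thesis by simp
qed

text \<open>
  A series in the conductor may be multiplied by every monomial \<open>t\<^sup>j\<close>, which moves its order to any
  larger integer; if its order were at most \<open>F\<close>, some multiple would have order \<open>F\<close>, which is not in \<open>S\<close>. Conversely,
  the integral closure is contained in \<open>k[[t]]\<close>.
\<close>
lemma conductor_semigroup_ring:
  assumes S: "numerical_semigroup S"
  shows "conductor (series_on (int ` S)) = (series_on {frobenius S<..} :: 'k::field fls set)"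
proof (intro equalityI subsetI)
  fix z :: "'k fls" assume z: "z \<in> conductor (series_on (int ` S))"
  show "z \<in> series_on {frobenius S<..}"
  proof (cases "z = 0")
    case False
    have "frobenius S < fls_subdegree z"
    proof (rule ccontr)
      assume "\<not> frobenius S < fls_subdegree z"
      then obtain j where j: "frobenius S = fls_subdegree z + int j"
        by (metis not_less zle_iff_zadd)
      have "z * fls_X ^ j \<in> series_on (int ` S)"
        using z fls_X_power_in_integral_closure[OF S, where 'k = 'k] by (auto simp: conductor_def)
      then have "fls_nth (z * fls_X ^ j) (frobenius S) = 0"
        using frobenius_notin[OF S] by (rule series_onD)
      then show False using False by (simp add: fls_X_power_times_conv_shift j)
    qed
    then show ?thesis by (intro series_onI) auto
  qed (simp add: series_on_def)
next
  fix z :: "'k fls" assume z: "z \<in> series_on {frobenius S<..}"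
  have "z * y \<in> series_on (int ` S)" if y: "y \<in> integral_closure (series_on (int ` S))" for y
  proof (rule series_on_mult[OF z])
    obtain p where p: "lead_coeff p = 1" "\<And>i. coeff p i \<in> series_on (int ` S)" "poly p y = 0"
      using y by (auto simp: integral_closure_def)
    have "int ` S \<subseteq> {0..}" by auto
    then have "coeff p i \<in> series_on {0..}" for i
      using p(2) series_on_mono by blast
    then show "y \<in> series_on {0..}"
      by (rule integral_over_power_series[OF p(1) _ p(3)])
  next
    fix a b :: int assume "a \<in> {frobenius S<..}" "b \<in> {0..}"
    then show "a + b \<in> int ` S" by (intro in_if_gt_frobenius[OF S]) auto
  qed
  then show "z \<in> conductor (series_on (int ` S))"
    using quotient_field_semigroup_ring[OF S, where 'k = 'k] by (auto simp: conductor_def)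
qed

text \<open>
  Comparing coefficients in \<open>r u = 1\<close> at a gap \<open>n\<close> of \<open>S\<close>: if \<open>i > 0\<close> and \<open>r\<^sub>i \<noteq> 0\<close>, then \<open>i\<close> is
  in \<open>S\<close>, whence \<open>n - i\<close> is a smaller gap and \<open>u\<^bsub>n-i\<^esub> = 0\<close> by induction; so \<open>r\<^sub>0 u\<^sub>n = 0\<close>.
\<close>
lemma inverse_in_semigroup_ring:
  fixes r :: "'k::field fls"
  assumes S: "numerical_semigroup S" and r: "r \<in> series_on (int ` S)" and r0: "fls_nth r 0 \<noteq> 0"
  shows "inverse r \<in> series_on (int ` S)"
proof -
  have r_neg: "fls_nth r n = 0" if "n < 0" for n using that r by (intro series_onD) auto
  then have sub: "fls_subdegree r = 0" using r0 by (intro fls_subdegree_eqI)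
  define u where "u = inverse r"
  have "r \<noteq> 0" using r0 by auto
  then have u: "r * u = 1" unfolding u_def by (rule right_inverse)
  have u_sub: "fls_subdegree u = 0" using sub by (simp add: u_def)
  have "int n \<notin> int ` S \<longrightarrow> fls_nth u (int n) = 0" for n
  proof (induction n rule: less_induct)
    case (less n)
    show ?case
    proof
      assume n: "int n \<notin> int ` S"
      then have "n \<noteq> 0" using S by (auto simp: numerical_semigroup_def)
      have "0 = fls_nth (r * u) (int n)" using \<open>n \<noteq> 0\<close> by (simp add: u)
      also have "\<dots> = (\<Sum>i=0..int n. fls_nth r i * fls_nth u (int n - i))"
        by (simp add: fls_times_nth(2) sub u_sub)
      also have "\<dots> = (\<Sum>i\<in>{0}. fls_nth r i * fls_nth u (int n - i))"
      proof (rule sum.mono_neutral_right)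
        show "\<forall>i\<in>{0..int n} - {0}. fls_nth r i * fls_nth u (int n - i) = 0"
        proof
          fix i assume i: "i \<in> {0..int n} - {0}"
          show "fls_nth r i * fls_nth u (int n - i) = 0"
          proof (cases "i \<in> int ` S")
            case True
            then have "int n - i \<notin> int ` S"
              using n int_add_in[OF S, of i "int n - i"] by auto
            then have "fls_nth u (int (nat (int n - i))) = 0"
              using less.IH[of "nat (int n - i)"] i by auto
            then show ?thesis using i by simp
          next
            case False
            then show ?thesis using series_onD[OF r] by simp
          qed
        qed
      qed auto
      finally show "fls_nth u (int n) = 0" using r0 by simp
    qed
  qed
  then have "u \<in> series_on (int ` S)"
  proof (intro series_onI)
    fix n assume n: "n \<notin> int ` S"
    show "fls_nth u n = 0"
    proof (cases "n < 0")
      case False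
      then have "int (nat n) = n" by simp
      then show ?thesis using n \<open>\<And>n. int n \<notin> int ` S \<longrightarrow> fls_nth u (int n) = 0\<close> by metis
    qed (simp add: u_sub)
  qed
  then show ?thesis by (simp add: u_def)
qed

lemma max_ideal_semigroup_ring:
  assumes S: "numerical_semigroup S"
  shows "max_ideal (series_on (int ` S)) = (series_on (int ` (S - {0})) :: 'k::field fls set)"
proof (intro equalityI subsetI)
  fix r :: "'k fls" assume r: "r \<in> max_ideal (series_on (int ` S))"
  then have R: "r \<in> series_on (int ` S)" by (simp add: max_ideal_def)
  have "fls_nth r 0 = 0"
  proof (rule ccontr)
    assume r0: "fls_nth r 0 \<noteq> 0"
    then have "r \<noteq> 0" by auto
    then have "r * inverse r = 1" by (rule right_inverse)
    then show False
      using r inverse_in_semigroup_ring[OF S R r0] unfolding max_ideal_def by blast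
  qed
  then show "r \<in> series_on (int ` (S - {0}))"
    using R by (force simp: series_on_def)
next
  fix r :: "'k fls" assume r: "r \<in> series_on (int ` (S - {0}))"
  have "r * u \<noteq> 1" if u: "u \<in> series_on (int ` S)" for u
  proof
    assume "r * u = 1"
    moreover have "r * u \<in> series_on {1..}"
      using r u by (rule series_on_mult) auto
    then have "fls_nth (r * u) 0 = 0" by (rule series_onD) simp
    ultimately show False by simp
  qed
  then show "r \<in> max_ideal (series_on (int ` S))"
    using r series_on_mono[of "int ` (S - {0})" "int ` S"] by (auto simp: max_ideal_def)
qed

text \<open>
  The quotient is spanned by the \<open>t\<^sup>n\<close> with \<open>n > F\<close> and \<open>n - m \<notin> S\<close>, and \<open>n - m\<close> is then a gap
  greater than \<open>F - m\<close>.
\<close>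
lemma reduced_type_eq_card:
  assumes S: "numerical_semigroup S"
  shows "reduced_type (k :: 'k::field itself) S
           = card {j. frobenius S - int (sg_mult S) < j \<and> j \<le> frobenius S \<and> j \<notin> int ` S}"
proof -
  define m where "m = sg_mult S"
  define G where "G = {j. frobenius S - int m < j \<and> j \<le> frobenius S \<and> j \<notin> int ` S}"
  let ?D = "(+) (int m) ` G" and ?B = "(+) (int m) ` int ` S"
  let ?W = "series_on ?B :: 'k fls set"
  let ?V = "{c + y | c y. c \<in> series_on {frobenius S<..} \<and> y \<in> ?W} :: 'k fls set"
  have "quot_dim ?V ?W = card ?D"
  proof (rule quot_dim_eq_card)
    have "G \<subseteq> {frobenius S - int m..frobenius S}" by (auto simp: G_def)
    then show "finite ?D" by (meson finite_imageI finite_subset finite_atLeastAtMost_int)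
    show "?D \<inter> ?B = {}" by (auto simp: G_def)
    have "{frobenius S<..} \<subseteq> ?D \<union> ?B"
    proof
      fix n assume n: "n \<in> {frobenius S<..}"
      have "n - int m \<in> G \<union> int ` S"
        using n in_if_gt_frobenius[OF S, of "n - int m"] by (force simp: G_def)
      then show "n \<in> ?D \<union> ?B" by (metis Un_iff add.commute diff_add_cancel image_eqI)
    qed
    then show "?V \<subseteq> series_on (?D \<union> ?B)"
      using series_on_mono[of "{frobenius S<..}" "?D \<union> ?B"] series_on_mono[of ?B "?D \<union> ?B"]
      by (auto intro!: series_on_add)
    have zero: "0 \<in> series_on A" for A :: "int set" by (simp add: series_on_def)
    show "fls_X_intpow n \<in> ?V" if "n \<in> ?D" for n
    proof -
      have "n \<in> {frobenius S<..}" using that by (auto simp: G_def)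
      then have "fls_X_intpow n + 0 \<in> ?V" using zero fls_X_intpow_in_series_on by blast
      then show ?thesis by simp
    qed
    have "0 + 0 \<in> ?V" using zero by blast
    then show "0 \<in> ?V" by simp
  qed
  also have "\<dots> = card G" by (rule card_image) simp
  finally show ?thesis
    by (simp add: reduced_type_def reduced_type_wrt_def semigroup_ring_eq_series_on[OF S]
        conductor_semigroup_ring[OF S] principal_series_on m_def G_def)
qed

lemma minimal_reduced_type_iff:
  assumes S: "numerical_semigroup S"
  shows "minimal_reduced_type (k :: 'k::field itself) S \<longleftrightarrow>
    (\<forall>j. frobenius S - int (sg_mult S) < j \<and> j < frobenius S \<longrightarrow> j \<in> int ` S)"
proof -
  define G where "G = {j. frobenius S - int (sg_mult S) < j \<and> j \<le> frobenius S \<and> j \<notin> int ` S}"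
  have F: "frobenius S \<in> G"
    using frobenius_notin[OF S] sg_mult_in[OF S] by (simp add: G_def)
  then have "card G = 1 \<longleftrightarrow> G = {frobenius S}"
    by (auto simp: card_1_singleton_iff)
  also have "\<dots> \<longleftrightarrow> (\<forall>j. j \<in> G \<longrightarrow> j = frobenius S)"
    using F by blast
  also have "\<dots> \<longleftrightarrow> (\<forall>j. frobenius S - int (sg_mult S) < j \<and> j < frobenius S \<longrightarrow> j \<in> int ` S)"
    unfolding G_def mem_Collect_eq using frobenius_notin[OF S] by (metis le_less less_irrefl)
  finally show ?thesis
    by (simp add: minimal_reduced_type_def reduced_type_eq_card[OF S] G_def)
qed

text \<open>
  The socle of \<open>k[[S]] / (t\<^sup>m)\<close> is spanned by the \<open>t\<^bsup>m + f\<^esup>\<close> with \<open>f\<close> a pseudo-Frobenius number, because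
  the maximal ideal consists of the series supported on the nonzero elements of \<open>S\<close> and it
  suffices to test with the monomials \<open>t\<^sup>s\<close>.
\<close>
lemma gorenstein_iff:
  assumes S: "numerical_semigroup S"
  shows "gorenstein (k :: 'k::field itself) S \<longleftrightarrow> card (pseudo_frobenius S) = 1"
proof -
  define m where "m = sg_mult S"
  have m: "m \<in> S - {0}" using sg_mult_in[OF S] by (simp add: m_def)
  let ?D = "(+) (int m) ` pseudo_frobenius S" and ?B = "(+) (int m) ` int ` S"
  let ?R = "series_on (int ` S) :: 'k fls set" and ?W = "series_on ?B :: 'k fls set"
  let ?V = "{r \<in> ?R. \<forall>y\<in>series_on (int ` (S - {0})). r * y \<in> ?W}"
  have "quot_dim ?V ?W = card ?D"
  proof (rule quot_dim_eq_card)
    show "finite ?D" using finite_pseudo_frobenius[OF S] by simp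
    show "?D \<inter> ?B = {}" by (auto simp: pseudo_frobenius_def)
    show "?V \<subseteq> series_on (?D \<union> ?B)"
    proof (intro subsetI series_onI)
      fix r n assume r: "r \<in> ?V" and n: "n \<notin> ?D \<union> ?B"
      have "int m + (n - int m) \<notin> ?D" "int m + (n - int m) \<notin> ?B" using n by simp_all
      then have "n - int m \<notin> pseudo_frobenius S" "n - int m \<notin> int ` S" by blast+
      then have "\<not> (\<forall>s\<in>S - {0}. n - int m + int s \<in> int ` S)"
        by (simp only: pseudo_frobenius_def mem_Collect_eq simp_thms)
      then obtain s where s: "s \<in> S - {0}" "n - int m + int s \<notin> int ` S"
        by blast
      have "fls_X ^ s \<in> series_on (int ` (S - {0}))"
        using s by (intro fls_X_power_in_series_on) auto
      then have "r * fls_X ^ s \<in> ?W" using r by blast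
      moreover have "n + int s \<notin> ?B" using s(2) by (auto simp: algebra_simps)
      ultimately have "fls_nth (r * fls_X ^ s) (n + int s) = 0" by (rule series_onD)
      then show "fls_nth r n = 0" by (simp add: fls_X_power_times_conv_shift)
    qed
    show "fls_X_intpow n \<in> ?V" if D: "n \<in> ?D" for n
    proof -
      obtain f where f: "f \<in> pseudo_frobenius S" "n = int m + f" using D by blast
      have "f + int m \<in> int ` S" using f(1) m unfolding pseudo_frobenius_def by blast
      then have "n \<in> int ` S" by (simp add: f(2) add.commute)
      moreover have "fls_X_intpow n * y \<in> ?W" if y: "y \<in> series_on (int ` (S - {0}))" for y
      proof (rule series_on_mult[OF fls_X_intpow_in_series_on y])
        show "n \<in> {n}" by simp
        fix a b assume "a \<in> {n}" "b \<in> int ` (S - {0})"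
        then have "a = int m + f" "f + b \<in> int ` S" using f by (auto simp: pseudo_frobenius_def)
        then show "a + b \<in> ?B" by (metis add.assoc image_eqI)
      qed
      ultimately show ?thesis by (simp add: fls_X_intpow_in_series_on)
    qed
    show "0 \<in> ?V" by (simp add: series_on_def)
  qed
  also have "\<dots> = card (pseudo_frobenius S)" by (rule card_image) simp
  finally show ?thesis
    by (simp add: gorenstein_def cm_type_wrt_def semigroup_ring_eq_series_on[OF S]
        max_ideal_semigroup_ring[OF S] principal_series_on m_def)
qed

text \<open>
  If \<open>F < m\<close>, then \<open>1, ..., m - 1\<close> are exactly the gaps, all in the interval of length \<open>m\<close> below
  \<open>F\<close>, so minimal reduced type leaves only one. This is the case in which the interval contains \<open>0\<close>.
\<close>
lemma eq_minus_1_if_frobenius_less_sg_mult: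
  assumes S: "numerical_semigroup S" "S \<noteq> UNIV"
    and min: "minimal_reduced_type (k :: 'k::field itself) S" and less: "frobenius S < int (sg_mult S)"
  shows "S = - {1}"
proof -
  have m: "2 \<le> sg_mult S" using frobenius_pos[OF S] less by simp
  then have "1 \<notin> S" using sg_mult_le[of 1 S] by auto
  then have "1 \<notin> int ` S" by auto
  then have "\<not> (frobenius S - int (sg_mult S) < 1 \<and> 1 < frobenius S)"
    using min minimal_reduced_type_iff[OF S(1)] by blast
  then have F: "frobenius S = 1" using frobenius_pos[OF S] less by simp
  have "n \<in> S" if "n \<noteq> 1" for n
  proof (cases "n = 0")
    case False
    then have "int n \<in> int ` S" using that F by (intro in_if_gt_frobenius[OF S(1)]) simp
    then show ?thesis by auto
  qed (use S in \<open>simp add: numerical_semigroup_def\<close>)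
  then show ?thesis using \<open>1 \<notin> S\<close> by auto
qed

lemma pseudo_frobenius_minus_1: "pseudo_frobenius (- {1}) \<subseteq> {1}"
proof
  fix f assume f: "f \<in> pseudo_frobenius (- {1})"
  then have notin: "f \<notin> int ` (- {1})" and add: "\<And>s. s \<in> - {1} - {0} \<Longrightarrow> f + int s \<in> int ` (- {1})"
    by (auto simp: pseudo_frobenius_def)
  show "f \<in> {1}"
  proof (cases "f < 0")
    case True
    then have "f + int (nat (1 - f)) \<in> int ` (- {1})" by (intro add) auto
    then show ?thesis using True by auto
  next
    case False
    then have "nat f = 1" using notin by (metis ComplI image_eqI int_nat_eq not_less singletonD)
    then show ?thesis by simp
  qed
qed

text \<open>
  The pseudo-Frobenius number above a gap \<open>j\<close> can only be \<open>F\<close>.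
\<close>
lemma gorenstein_symmetric:
  assumes S: "numerical_semigroup S" and gor: "gorenstein (k :: 'k::field itself) S"
    and j: "j \<notin> int ` S"
  shows "frobenius S - j \<in> int ` S"
proof -
  obtain f where f: "f \<notin> int ` S" "f - j \<in> int ` S" "\<And>s. s \<in> S - {0} \<Longrightarrow> f + int s \<in> int ` S"
    using maximal_gap_above[OF in_if_gt_frobenius[OF S] S j] by blast
  then have "f \<in> pseudo_frobenius S" by (simp add: pseudo_frobenius_def)
  then have "f = frobenius S"
    using gor card_pseudo_frobenius_eq_1_iff[OF S] gorenstein_iff[OF S] by blast
  then show ?thesis using f by simp
qed

lemma gorenstein_imp_minimal_reduced_type:
  assumes S: "numerical_semigroup S" and gor: "gorenstein (k :: 'k::field itself) S"
  shows "minimal_reduced_type k S"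
  unfolding minimal_reduced_type_iff[OF S]
proof (intro allI impI, rule ccontr)
  fix j assume j: "frobenius S - int (sg_mult S) < j \<and> j < frobenius S" and "j \<notin> int ` S"
  then have "int (sg_mult S) \<le> frobenius S - j"
    using gorenstein_symmetric[OF S gor] by (intro sg_mult_le_int) auto
  then show False using j by simp
qed

section \<open>The numerical duplication\<close>

text \<open>
  The integer \<open>g\<close> is the largest one outside \<open>E\<close>. For \<open>E = S\<close> it is the Frobenius number of \<open>S\<close>, and
  for \<open>0 \<notin> E\<close> with a positive integer missing from \<open>E\<close> it is that of \<open>E \<union> {0}\<close>. Its existence forces \<open>E\<close> to be nonempty.
\<close>
locale ideal_duplication =
  fixes S E :: "nat set" and d :: nat and g :: int
  assumes S: "numerical_semigroup S" and E: "semigroup_ideal S E"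
    and d: "d \<in> S" "odd d"
    and g_notin: "g \<notin> int ` E" and gt_g: "\<And>n. g < n \<Longrightarrow> n \<in> int ` E"
begin

abbreviation "T \<equiv> duplication S E d"

lemma d_pos: "0 < d"
  using d(2) by (rule odd_pos)

lemma E_subset: "int ` E \<subseteq> int ` S"
  using E by (auto simp: semigroup_ideal_def)

lemma frobenius_le: "frobenius S \<le> g"
  using gt_g[of "frobenius S"] E_subset frobenius_notin[OF S] by (meson not_le subset_iff)

lemma E_nonempty: "E \<noteq> {}"
  using gt_g[of "g + 1"] by auto

lemma T: "numerical_semigroup T"
  by (rule numerical_semigroup_duplication[OF S E E_nonempty d])

lemma T_cases:
  assumes "n \<in> int ` T"
  obtains (even) s where "s \<in> S" "n = 2 * int s" | (odd) e where "e \<in> E" "n = 2 * int e + int d"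
  using assms by (auto simp: duplication_def)

lemma even_in_T_iff: "2 * j \<in> int ` T \<longleftrightarrow> j \<in> int ` S"
proof
  assume "2 * j \<in> int ` T"
  then show "j \<in> int ` S"
  proof (cases rule: T_cases)
    case (odd e)
    then have "int d = 2 * (j - int e)" by simp
    then have "even (int d)" by simp
    then show ?thesis using d(2) by simp
  qed simp
next
  assume "j \<in> int ` S"
  then obtain s where s: "s \<in> S" "2 * j = int (2 * s)" by auto
  then have "2 * s \<in> T" by (auto simp: duplication_def)
  then show "2 * j \<in> int ` T" unfolding s(2) by (rule imageI)
qed

lemma odd_in_T_iff: "2 * j + int d \<in> int ` T \<longleftrightarrow> j \<in> int ` E"
proof
  assume "2 * j + int d \<in> int ` T"
  then show "j \<in> int ` E"
  proof (cases rule: T_cases)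
    case (even s)
    then have "int d = 2 * (int s - j)" by simp
    then have "even (int d)" by simp
    then show ?thesis using d(2) by simp
  qed simp
next
  assume "j \<in> int ` E"
  then obtain e where e: "e \<in> E" "2 * j + int d = int (2 * e + d)" by auto
  then have "2 * e + d \<in> T" by (auto simp: duplication_def)
  then show "2 * j + int d \<in> int ` T" unfolding e(2) by (rule imageI)
qed

text \<open>
  Since \<open>d\<close> is odd, these two forms account for all integers, and membership in \<open>T\<close> reduces to
  membership of \<open>j\<close> in \<open>S\<close> or in \<open>E\<close>.
\<close>
lemma parity_cases:
  obtains (even) j where "n = 2 * j" | (odd) j where "n = 2 * j + int d"
proof (cases "even n")
  case False
  then have "even (n - int d)" using d by simp
  then obtain j where "n - int d = 2 * j" by (rule evenE)
  then show thesis by (intro odd[of j]) simp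
qed (blast elim: evenE intro: even)

lemma frobenius_T: "frobenius T = 2 * g + int d"
proof (rule frobenius_eqI[OF T])
  show "2 * g + int d \<notin> int ` T" using g_notin by (simp add: odd_in_T_iff)
  fix n assume n: "2 * g + int d < n"
  show "n \<in> int ` T"
  proof (cases n rule: parity_cases)
    case (even j)
    then show ?thesis using n gt_g[of j] E_subset by (auto simp: even_in_T_iff)
  next
    case (odd j)
    then show ?thesis using n gt_g[of j] by (simp add: odd_in_T_iff)
  qed
qed

lemma sg_mult_T:
  assumes "0 \<notin> E"
  shows "sg_mult T = 2 * sg_mult S"
proof (rule antisym)
  have "2 * sg_mult S \<in> T" using sg_mult_in(1)[OF S] by (auto simp: duplication_def)
  then show "sg_mult T \<le> 2 * sg_mult S"
    using sg_mult_in(2)[OF S] by (intro sg_mult_le) auto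
  from sg_mult_in[OF T] consider s where "s \<in> S" "sg_mult T = 2 * s" "s \<noteq> 0"
    | e where "e \<in> E" "sg_mult T = 2 * e + d"
    by (auto simp: duplication_def)
  then show "2 * sg_mult S \<le> sg_mult T"
  proof cases
    case 1
    then show ?thesis using sg_mult_le[of s S] by simp
  next
    case 2
    then have "e \<in> S" "e \<noteq> 0" using E assms by (auto simp: semigroup_ideal_def intro!: gr0I)
    then show ?thesis using sg_mult_le[of e S] 2 by simp
  qed
qed

end

text \<open>
  For the odd elements of \<open>T\<close>, note that \<open>2 f + d + (2 e + d) = 2 (f + (e + d))\<close>, where \<open>e + d\<close> is a
  nonzero element of \<open>S\<close>.
\<close>
lemma (in ideal_duplication) odd_pseudo_frobenius_T:
  assumes f: "f \<notin> int ` E" and add: "\<And>s. s \<in> S - {0} \<Longrightarrow> f + int s \<in> int ` E"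
  shows "2 * f + int d \<in> pseudo_frobenius T"
proof -
  have "2 * f + int d + int t \<in> int ` T" if t: "t \<in> T - {0}" for t
  proof -
    from t have "int t \<in> int ` T" by blast
    then show ?thesis
    proof (cases rule: T_cases)
      case (even s)
      then have "f + int s \<in> int ` E" using t by (intro add) auto
      then have "2 * (f + int s) + int d \<in> int ` T" by (simp only: odd_in_T_iff)
      then show ?thesis using even by (simp add: algebra_simps)
    next
      case (odd e)
      have "e \<in> S" using odd E by (auto simp: semigroup_ideal_def)
      then have "e + d \<in> S - {0}" using S d(1) d_pos by (auto simp: numerical_semigroup_def)
      then have "f + int (e + d) \<in> int ` S" using add E_subset by blast
      then have "2 * (f + int (e + d)) \<in> int ` T" by (simp only: even_in_T_iff)
      then show ?thesis using odd by (simp add: algebra_simps)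
    qed
  qed
  moreover have "2 * f + int d \<notin> int ` T" using f by (simp only: odd_in_T_iff not_False_eq_True)
  ultimately show ?thesis by (simp add: pseudo_frobenius_def)
qed

locale proper_ideal_duplication = ideal_duplication +
  assumes zero_notin: "0 \<notin> E"
begin

text \<open>
  The odd integers \<open>2 j + d\<close> in the interval of length \<open>2 m\<close> below the Frobenius number \<open>2 g + d\<close> give
  the condition on \<open>E\<close>. Among the even integers, \<open>2 F\<close> is the largest one outside \<open>T\<close>, and \<open>F \<le> g\<close>
  keeps it below \<open>2 g + d\<close>; so the even integers in the interval all lie in \<open>T\<close> iff \<open>2 F\<close> is not in it.
\<close>
lemma minimal_reduced_type_T_iff:
  "minimal_reduced_type (k :: 'k::field itself) T \<longleftrightarrow>
     (\<forall>j. g - int (sg_mult S) < j \<and> j < g \<longrightarrow> j \<in> int ` E) \<and>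
     2 * (frobenius S - g + int (sg_mult S)) < int d"
  (is "_ \<longleftrightarrow> ?odd \<and> ?even")
proof -
  define m where "m = int (sg_mult S)"
  have "minimal_reduced_type k T \<longleftrightarrow>
      (\<forall>n. 2 * g + int d - 2 * m < n \<and> n < 2 * g + int d \<longrightarrow> n \<in> int ` T)" (is "_ \<longleftrightarrow> ?all")
    by (simp add: minimal_reduced_type_iff[OF T] frobenius_T sg_mult_T[OF zero_notin] m_def)
  also have "\<dots> \<longleftrightarrow> ?odd \<and> ?even"
  proof (intro iffI conjI allI impI)
    fix j assume all: ?all and "g - int (sg_mult S) < j \<and> j < g"
    then have "2 * j + int d \<in> int ` T" by (simp add: m_def)
    then show "j \<in> int ` E" by (simp only: odd_in_T_iff)
  next
    assume all: ?all
    show ?even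
    proof (rule ccontr)
      assume "\<not> ?even"
      moreover have "2 * (frobenius S - g + m) \<noteq> int d"
      proof
        assume "2 * (frobenius S - g + m) = int d"
        then have "even (int d)" by (metis dvd_triv_left)
        then show False using d by simp
      qed
      ultimately have "2 * frobenius S \<in> int ` T"
        using all frobenius_le d_pos by (simp add: m_def)
      then show False using frobenius_notin[OF S] by (simp only: even_in_T_iff)
    qed
  next
    fix n assume odd_even: "?odd \<and> ?even" and n: "2 * g + int d - 2 * m < n \<and> n < 2 * g + int d"
    show "n \<in> int ` T"
    proof (cases n rule: parity_cases)
      case (even j)
      then have "frobenius S < j" using odd_even n by (simp add: m_def)
      then show ?thesis unfolding even even_in_T_iff by (rule in_if_gt_frobenius[OF S])
    next
      case (odd j)
      then have "g - int (sg_mult S) < j \<and> j < g" using n by (simp add: m_def)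
      then show ?thesis unfolding odd odd_in_T_iff using odd_even by blast
    qed
  qed
  finally show ?thesis .
qed

text \<open>
  This makes the set \<open>PF'(T)\<close> nonempty, so that its maximum is meaningful and at least \<open>2 F\<close>.
\<close>
lemma two_frobenius_in_pseudo_frobenius'_T:
  assumes g: "frobenius S = g"
  shows "2 * frobenius S \<in> pseudo_frobenius' T"
proof -
  have "2 * frobenius S + int t \<in> int ` T" if t: "t \<in> T - {0}" for t
  proof -
    from t have "int t \<in> int ` T" by blast
    then show ?thesis
    proof (cases rule: T_cases)
      case (even s)
      then have "frobenius S + int s \<in> int ` S" using t by (intro in_if_gt_frobenius[OF S]) simp
      then have "2 * (frobenius S + int s) \<in> int ` T" by (simp only: even_in_T_iff)
      then show ?thesis using even by simp
    next
      case (odd e)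
      then have "e \<noteq> 0" using zero_notin by metis
      then have "frobenius S + int e \<in> int ` E" using g by (intro gt_g) simp
      then have "2 * (frobenius S + int e) + int d \<in> int ` T" by (simp only: odd_in_T_iff)
      then show ?thesis using odd by (simp add: algebra_simps)
    qed
  qed
  moreover have "2 * frobenius S \<notin> int ` T"
    using frobenius_notin[OF S] by (simp only: even_in_T_iff not_False_eq_True)
  moreover have "2 * frobenius S \<noteq> frobenius T"
    using d_pos by (simp add: frobenius_T g)
  ultimately show ?thesis by (simp add: pseudo_frobenius'_def pseudo_frobenius_def)
qed

lemma finite_pseudo_frobenius'_T: "finite (pseudo_frobenius' T)"
  using finite_pseudo_frobenius[OF T] by (simp add: pseudo_frobenius'_def)

text \<open>
  Suppose \<open>2 m < d\<close> and some \<open>j\<close> between \<open>g - m\<close> and \<open>g\<close> is not in \<open>E\<close>. The maximal \<open>f \<notin> E\<close> in \<open>j + S\<close>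
  differs from \<open>g\<close>, since \<open>g - j < m\<close>. Then \<open>2 f + d\<close> is in \<open>PF'(T)\<close> and exceeds
  \<open>2 g - 2 m + d > 2 g\<close>, against the assumption on the maximum.
\<close>
lemma minimal_reduced_type_T_if_max_eq:
  assumes g: "frobenius S = g" and max: "Max (pseudo_frobenius' T) = 2 * frobenius S"
  shows "minimal_reduced_type (k :: 'k::field itself) T \<longleftrightarrow> 2 * sg_mult S < d"
proof -
  have "j \<in> int ` E" if d_gt: "2 * sg_mult S < d" and j: "g - int (sg_mult S) < j" "j < g" for j
  proof (rule ccontr)
    assume "j \<notin> int ` E"
    then obtain f where f: "f \<notin> int ` E" "f - j \<in> int ` S" "\<And>s. s \<in> S - {0} \<Longrightarrow> f + int s \<in> int ` E"
      using maximal_gap_above[OF gt_g S] by blast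
    have "f \<noteq> g"
    proof
      assume "f = g"
      then have "int (sg_mult S) \<le> g - j" using f(2) j by (intro sg_mult_le_int) auto
      then show False using j by simp
    qed
    then have "2 * f + int d \<in> pseudo_frobenius' T"
      using odd_pseudo_frobenius_T[OF f(1,3)] by (simp add: pseudo_frobenius'_def frobenius_T)
    then have "2 * f + int d \<le> 2 * g"
      using Max_ge[OF finite_pseudo_frobenius'_T] max g by metis
    moreover have "j \<le> f" using f(2) by auto
    ultimately show False using j d_gt by linarith
  qed
  then show ?thesis by (auto simp: minimal_reduced_type_T_iff g)
qed

text \<open>
  The maximum of \<open>PF'(T)\<close> is now greater than \<open>2 F\<close>, hence odd, say \<open>2 j + d\<close>. As \<open>j \<notin> E\<close> and \<open>j \<noteq> g\<close>,
  the hypothesis on \<open>E\<close> puts \<open>j\<close> at or below \<open>g - m\<close>, and \<open>2 j + d > 2 F = 2 g\<close> gives \<open>d > 2 m\<close>.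
  The parameter \<open>m\<close> is meant to be the multiplicity of \<open>E \<union> {0}\<close>, which may exceed that of \<open>S\<close>.
\<close>
lemma minimal_reduced_type_T_if_max_neq:
  assumes g: "frobenius S = g" and max: "Max (pseudo_frobenius' T) \<noteq> 2 * frobenius S"
    and mem: "\<And>j. g - int m < j \<Longrightarrow> j < g \<Longrightarrow> j \<in> int ` E" and m: "sg_mult S \<le> m"
  shows "minimal_reduced_type (k :: 'k::field itself) T"
proof -
  define p where "p = Max (pseudo_frobenius' T)"
  have p: "p \<in> pseudo_frobenius' T"
    unfolding p_def using two_frobenius_in_pseudo_frobenius'_T[OF g] finite_pseudo_frobenius'_T
    by (intro Max_in) auto
  have "2 * frobenius S \<le> p"
    unfolding p_def by (intro Max_ge finite_pseudo_frobenius'_T two_frobenius_in_pseudo_frobenius'_T g)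
  then have gt: "2 * g < p" using max g by (simp add: p_def)
  have notin: "p \<notin> int ` T" and neq: "p \<noteq> 2 * g + int d"
    using p by (auto simp: pseudo_frobenius'_def pseudo_frobenius_def frobenius_T)
  have "2 * sg_mult S < d"
  proof (cases p rule: parity_cases)
    case (even j)
    then show ?thesis using notin gt in_if_gt_frobenius[OF S, of j] g by (simp add: even_in_T_iff)
  next
    case (odd j)
    have j: "j \<notin> int ` E" using notin by (simp add: odd odd_in_T_iff)
    have "j \<noteq> g" using neq odd by simp
    then have "j \<le> g - int m" using j gt_g[of j] mem[of j] by linarith
    then show ?thesis using gt odd m by linarith
  qed
  then show ?thesis
    unfolding minimal_reduced_type_T_iff using mem m g by auto
qed

end

text \<open>
  Here \<open>0 \<in> E\<close>, so \<open>d\<close> is in \<open>T\<close> and the multiplicity of \<open>T\<close> is at most \<open>d\<close> and at most \<open>2 m\<close>. The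
  first bound keeps the interval above \<open>2 F\<close>, which settles the even integers; the second
  reduces the odd ones to the interval of \<open>S\<close>.
\<close>
lemma minimal_reduced_type_duplication_self:
  assumes S: "numerical_semigroup S" and d: "d \<in> S" "odd d"
    and min: "minimal_reduced_type (k :: 'k::field itself) S"
  shows "minimal_reduced_type k (duplication S S d)"
proof -
  interpret ideal_duplication S S d "frobenius S"
    using S d frobenius_notin[OF S] in_if_gt_frobenius[OF S]
    by unfold_locales (auto simp: semigroup_ideal_def numerical_semigroup_def)
  have "d \<in> T" "2 * sg_mult S \<in> T"
    using S sg_mult_in[OF S] by (auto simp: duplication_def numerical_semigroup_def)
  then have mult: "sg_mult T \<le> d" "sg_mult T \<le> 2 * sg_mult S"
    using d_pos sg_mult_in[OF S] by (auto intro!: sg_mult_le)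
  show ?thesis
    unfolding minimal_reduced_type_iff[OF T] frobenius_T
  proof (intro allI impI)
    fix n assume n: "2 * frobenius S + int d - int (sg_mult T) < n \<and> n < 2 * frobenius S + int d"
    show "n \<in> int ` T"
    proof (cases n rule: parity_cases)
      case (even j)
      then have "frobenius S < j" using n mult by linarith
      then show ?thesis unfolding even even_in_T_iff by (rule in_if_gt_frobenius[OF S])
    next
      case (odd j)
      then have "frobenius S - int (sg_mult S) < j \<and> j < frobenius S" using n mult by linarith
      then show ?thesis
        unfolding odd odd_in_T_iff using min minimal_reduced_type_iff[OF S] by blast
    qed
  qed
qed

lemma duplication_maximal_ideal:
  assumes S: "numerical_semigroup S" "S \<noteq> UNIV" and d: "d \<in> S" "odd d"
  shows "proper_ideal_duplication S (S - {0}) d (frobenius S)"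
proof
  show "numerical_semigroup S" "d \<in> S" "odd d" by fact+
  show "semigroup_ideal S (S - {0})"
    using S by (auto simp: semigroup_ideal_def numerical_semigroup_def)
  show "frobenius S \<notin> int ` (S - {0})" using frobenius_notin[OF S(1)] by auto
  show "n \<in> int ` (S - {0})" if "frobenius S < n" for n
    using in_if_gt_frobenius[OF S(1) that] frobenius_pos[OF S] that by auto
qed simp

text \<open>
  For \<open>E = S - {0}\<close> the condition on \<open>E\<close> differs from minimal reduced type of \<open>S\<close> only at \<open>0\<close>, which
  is in the interval iff \<open>F < m\<close>.
\<close>
lemma minimal_reduced_type_duplication_maximal_ideal_iff:
  assumes S: "numerical_semigroup S" "S \<noteq> UNIV" and d: "d \<in> S" "odd d"
    and min: "minimal_reduced_type (k :: 'k::field itself) S"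
  shows "minimal_reduced_type k (duplication S (S - {0}) d) \<longleftrightarrow>
           int (sg_mult S) < frobenius S \<and> 2 * sg_mult S < d"
proof -
  interpret proper_ideal_duplication S "S - {0}" d "frobenius S"
    by (rule duplication_maximal_ideal[OF S d])
  have neq: "frobenius S \<noteq> int (sg_mult S)"
    using frobenius_notin[OF S(1)] sg_mult_in[OF S(1)] by auto
  have "(\<forall>j. frobenius S - int (sg_mult S) < j \<and> j < frobenius S \<longrightarrow> j \<in> int ` (S - {0})) \<longleftrightarrow>
      int (sg_mult S) < frobenius S" (is "?all \<longleftrightarrow> ?less")
  proof
    assume ?all
    then have "\<not> (frobenius S - int (sg_mult S) < 0 \<and> 0 < frobenius S)" by force
    then show ?less using frobenius_pos[OF assms(1,2)] neq by linarith
  next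
    assume ?less
    show ?all
    proof (intro allI impI)
      fix j assume j: "frobenius S - int (sg_mult S) < j \<and> j < frobenius S"
      then have "j \<in> int ` S" using min minimal_reduced_type_iff[OF S(1)] by blast
      then show "j \<in> int ` (S - {0})" using j \<open>?less\<close> by auto
    qed
  qed
  then show ?thesis unfolding minimal_reduced_type_T_iff by auto
qed

text \<open>
  Besides the Frobenius number \<open>2 F + d\<close>, also \<open>d\<close> is a pseudo-Frobenius number of \<open>T\<close>, because
  \<open>0 \<notin> E\<close> and \<open>E\<close> contains all nonzero elements of \<open>S\<close>.
\<close>
lemma not_gorenstein_duplication_maximal_ideal:
  assumes S: "numerical_semigroup S" "S \<noteq> UNIV" and d: "d \<in> S" "odd d"
  shows "\<not> gorenstein (k :: 'k::field itself) (duplication S (S - {0}) d)"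
proof
  interpret proper_ideal_duplication S "S - {0}" d "frobenius S"
    by (rule duplication_maximal_ideal[OF S d])
  assume "gorenstein k T"
  then have "pseudo_frobenius T = {2 * frobenius S + int d}"
    using card_pseudo_frobenius_eq_1_iff[OF T] gorenstein_iff[OF T] frobenius_T by metis
  moreover have "2 * 0 + int d \<in> pseudo_frobenius T"
    by (rule odd_pseudo_frobenius_T) auto
  ultimately show False using frobenius_pos[OF assms(1,2)] by simp
qed

theorem theorem5p5:
  fixes S E :: "nat set" and d :: nat and k :: "'k::{alg_closed_field, field_char_0} itself"
  assumes "numerical_semigroup S"
    and "semigroup_ideal S E" and "E \<noteq> {}"
    and "d \<in> S" and "odd d"
  shows
    \<comment> \<open>(i)\<close>
    "(E = S \<longrightarrow>
        minimal_reduced_type k S \<longrightarrow> minimal_reduced_type k (duplication S E d))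
     \<and>
     (E = S - {0} \<and> S \<noteq> UNIV \<longrightarrow>
        \<not> gorenstein k (duplication S E d)
        \<and> (gorenstein k S \<longrightarrow>
             (int d < 2 * frobenius S \<longrightarrow>
                (minimal_reduced_type k (duplication S E d) \<longleftrightarrow> 2 * sg_mult S < d))
             \<and> (int d > 2 * frobenius S \<longrightarrow>
                (minimal_reduced_type k (duplication S E d) \<longleftrightarrow>
                   int (sg_mult S) < frobenius S + 1)))
        \<and> (\<not> gorenstein k S \<longrightarrow>
             (Max (pseudo_frobenius' (duplication S E d)) \<noteq> 2 * frobenius S \<longrightarrow>
                minimal_reduced_type k S \<longrightarrow> minimal_reduced_type k (duplication S E d))
             \<and> (Max (pseudo_frobenius' (duplication S E d)) = 2 * frobenius S \<longrightarrow>
                (minimal_reduced_type k (duplication S E d) \<longleftrightarrow> d > 2 * sg_mult S))))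
     \<and>
     (E \<noteq> S \<and> E \<noteq> S - {0} \<longrightarrow>
        (frobenius S \<noteq> frobenius (E \<union> {0}) \<longrightarrow>
           minimal_reduced_type k (E \<union> {0}) \<longrightarrow> minimal_reduced_type k (duplication S E d))
        \<and> (frobenius S = frobenius (E \<union> {0}) \<longrightarrow>
             (Max (pseudo_frobenius' (duplication S E d)) \<noteq> 2 * frobenius S \<longrightarrow>
                minimal_reduced_type k (E \<union> {0}) \<longrightarrow>
                minimal_reduced_type k (duplication S E d))
             \<and> (Max (pseudo_frobenius' (duplication S E d)) = 2 * frobenius S \<longrightarrow>
                (minimal_reduced_type k (duplication S E d) \<longleftrightarrow> d > 2 * sg_mult S))))"
proof (rule conjI[OF _ conjI]; intro impI)
  note S = assms(1) and d = assms(4,5)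
  {
    assume "E = S" "minimal_reduced_type k S"
    then show "minimal_reduced_type k (duplication S E d)"
      using minimal_reduced_type_duplication_self[OF S d] by simp
  next
    assume "E = S - {0} \<and> S \<noteq> UNIV"
    then have E_eq: "E = S - {0}" and S_UNIV: "S \<noteq> UNIV" by auto
    interpret proper_ideal_duplication S E d "frobenius S"
      unfolding E_eq by (rule duplication_maximal_ideal[OF S S_UNIV d])
    have min_iff: "minimal_reduced_type k T \<longleftrightarrow> int (sg_mult S) < frobenius S \<and> 2 * sg_mult S < d"
      if "minimal_reduced_type k S"
      using minimal_reduced_type_duplication_maximal_ideal_iff[OF S S_UNIV d that] by (simp add: E_eq)
    have neq: "int (sg_mult S) \<noteq> frobenius S"
      using frobenius_notin[OF S] sg_mult_in(1)[OF S] by (metis image_eqI)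
    have "minimal_reduced_type k T"
      if non_gor: "\<not> gorenstein k S" and max: "Max (pseudo_frobenius' T) \<noteq> 2 * frobenius S"
        and min: "minimal_reduced_type k S"
    proof (rule minimal_reduced_type_T_if_max_neq[OF refl max])
      \<comment> \<open>Otherwise 1 would be the only gap, and k[[S]] would be Gorenstein.\<close>
      have less: "int (sg_mult S) < frobenius S"
      proof (rule ccontr)
        assume "\<not> int (sg_mult S) < frobenius S"
        then have eq: "S = - {1}"
          using neq by (intro eq_minus_1_if_frobenius_less_sg_mult[OF S S_UNIV min]) linarith
        have "pseudo_frobenius S \<subseteq> {1}"
          by (subst eq) (rule pseudo_frobenius_minus_1)
        then have "pseudo_frobenius S = {1}"
          using frobenius_in_pseudo_frobenius[OF S] by (metis empty_iff subset_singletonD)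
        then show False using non_gor gorenstein_iff[OF S, of k] by simp
      qed
      fix j assume j: "frobenius S - int (sg_mult S) < j" "j < frobenius S"
      then have "j \<in> int ` S" using min minimal_reduced_type_iff[OF S] by blast
      then show "j \<in> int ` E" using j less by (auto simp: E_eq)
    qed simp
    then show "\<not> gorenstein k T
        \<and> (gorenstein k S \<longrightarrow>
             (int d < 2 * frobenius S \<longrightarrow>
                (minimal_reduced_type k T \<longleftrightarrow> 2 * sg_mult S < d))
             \<and> (int d > 2 * frobenius S \<longrightarrow>
                (minimal_reduced_type k T \<longleftrightarrow> int (sg_mult S) < frobenius S + 1)))
        \<and> (\<not> gorenstein k S \<longrightarrow>
             (Max (pseudo_frobenius' T) \<noteq> 2 * frobenius S \<longrightarrow>
                minimal_reduced_type k S \<longrightarrow> minimal_reduced_type k T)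
             \<and> (Max (pseudo_frobenius' T) = 2 * frobenius S \<longrightarrow>
                (minimal_reduced_type k T \<longleftrightarrow> d > 2 * sg_mult S)))"
      using not_gorenstein_duplication_maximal_ideal[OF S S_UNIV d, of k, folded E_eq]
        min_iff[OF gorenstein_imp_minimal_reduced_type[OF S]] neq
        minimal_reduced_type_T_if_max_eq[OF refl, of k]
      by auto
  next
    assume neq: "E \<noteq> S \<and> E \<noteq> S - {0}"
    let ?E = "E \<union> {0}"
    have sub: "E \<subseteq> S" and ideal: "\<And>s e. s \<in> S \<Longrightarrow> e \<in> E \<Longrightarrow> s + e \<in> E" and zero: "0 \<in> S"
      using assms(1,2) by (auto simp: semigroup_ideal_def numerical_semigroup_def)
    have E0: "0 \<notin> E" using ideal[of _ 0] neq sub by force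
    have E_num: "numerical_semigroup ?E"
      using numerical_semigroup_insert_0_ideal[OF assms(1-3)] by simp
    have E_neq: "?E \<noteq> S" using neq E0 by blast
    \<comment> \<open>If every positive integer were in E, then E would be S - {0}.\<close>
    have E_UNIV: "?E \<noteq> UNIV" using E_neq sub zero by blast
    note pos = frobenius_pos[OF E_num E_UNIV]
    interpret proper_ideal_duplication S E d "frobenius ?E"
    proof
      show "frobenius ?E \<notin> int ` E" using frobenius_notin[OF E_num] by blast
      show "n \<in> int ` E" if "frobenius ?E < n" for n
        using in_if_gt_frobenius[OF E_num that] pos that by auto
    qed (use assms E0 in auto)
    have mult: "sg_mult S \<le> sg_mult ?E"
      using sg_mult_in[OF E_num] sub by (intro sg_mult_le) auto
    have mem: "j \<in> int ` E"
      if "minimal_reduced_type k ?E" "frobenius ?E - int m < j" "j < frobenius ?E"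
        "m \<le> sg_mult ?E" "int m \<le> frobenius ?E" for j m
    proof -
      have "frobenius ?E - int (sg_mult ?E) < j \<and> j < frobenius ?E" using that by linarith
      then have "j \<in> int ` ?E" using that(1) minimal_reduced_type_iff[OF E_num] by blast
      moreover have "j \<noteq> 0" using that by linarith
      ultimately show ?thesis by auto
    qed
    have neq_F: "minimal_reduced_type k T" if F: "frobenius S \<noteq> frobenius ?E" and min: "minimal_reduced_type k ?E"
    proof -
      \<comment> \<open>F is missing from E, hence lies below the interval, and the condition on d holds for every d > 0.\<close>
      have less: "frobenius S < frobenius ?E" using F frobenius_le by simp
      then have "frobenius ?E \<in> int ` S" by (rule in_if_gt_frobenius[OF S])
      then have "int (sg_mult S) \<le> frobenius ?E" using pos by (intro sg_mult_le_int) auto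
      note mem = mem[OF min _ _ mult this]
      then have "frobenius S \<le> frobenius ?E - int (sg_mult S)"
        using less frobenius_notin[OF S] E_subset by (meson not_less subsetD)
      then show ?thesis
        unfolding minimal_reduced_type_T_iff using mem d_pos by auto
    qed
    have eq_F: "minimal_reduced_type k T"
      if F: "frobenius S = frobenius ?E" and max: "Max (pseudo_frobenius' T) \<noteq> 2 * frobenius S"
        and min: "minimal_reduced_type k ?E"
    proof (rule minimal_reduced_type_T_if_max_neq[OF F max _ mult])
      \<comment> \<open>Otherwise 1 would be the only natural number missing from the union of E and {0}. That leaves only S = UNIV, whose Frobenius number is -1.\<close>
      have "int (sg_mult ?E) \<le> frobenius ?E"
      proof (rule ccontr)
        assume "\<not> int (sg_mult ?E) \<le> frobenius ?E"
        then have "?E = - {1}"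
          using eq_minus_1_if_frobenius_less_sg_mult[OF E_num E_UNIV min] by simp
        then have "S = UNIV" using E_neq sub zero by blast
        then show False using F pos by (simp add: frobenius_def)
      qed
      then show "j \<in> int ` E" if "frobenius ?E - int (sg_mult ?E) < j" "j < frobenius ?E" for j
        using mem[OF min that] by simp
    qed
    show "(frobenius S \<noteq> frobenius ?E \<longrightarrow>
           minimal_reduced_type k ?E \<longrightarrow> minimal_reduced_type k T)
        \<and> (frobenius S = frobenius ?E \<longrightarrow>
             (Max (pseudo_frobenius' T) \<noteq> 2 * frobenius S \<longrightarrow>
                minimal_reduced_type k ?E \<longrightarrow> minimal_reduced_type k T)
             \<and> (Max (pseudo_frobenius' T) = 2 * frobenius S \<longrightarrow>
                (minimal_reduced_type k T \<longleftrightarrow> d > 2 * sg_mult S)))"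
      using neq_F eq_F minimal_reduced_type_T_if_max_eq[of k] by blast
  }
qed

end
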